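(* Suppose $2\le t\le\min\{k_2,d\}$. For $k_1\ge2$, the ideal $I_\emptyset$ is radical. For $k_1=2$, the ideals $I_S$ and $J_S$ are radical for all minimal $S\subseteq[2]\times[k_2]$.
   Context: Let $k_1,k_2,d,t$ be integers; $[n]=\{1,\dots,n\}$. Let $X=(x_{i(j,\ell)})$ be the $d\times k_1k_2$ matrix of indeterminates with rows $i\in[d]$ and columns $(j,\ell)\in[k_1]\times[k_2]$, and $\mathbb C[X]$ the polynomial ring over $\mathbb C$ in its entries. For $U\subseteq[k_1]\times[k_2]$, $X_U$ is the submatrix of $X$ with columns in $U$. For a submatrix $Y$ of $X$, $F_r(Y)$ is the set of $r$-minors of $Y$ and $I_r(Y)$ the ideal of $\mathbb C[X]$ it generates. Put $R_i=\{i\}\times[k_2]$ and $C_j=[k_1]\times\{j\}$. For any $k_1\ge2$, $J_\emptyset=I_\emptyset=I_t(X)+\sum_{j=1}^{k_2}I_2(X_{C_j})$. Let now $k_1=2$. If $S\subseteq[2]\times[k_2]$ contains no $C_j$, its combinatorial type is $(u,v)$ with $u=\min\{|R_1\cap S|,|R_2\cap S|\}$, $v=\max\{|R_1\cap S|,|R_2\cap S|\}$. $S$ is called minimal if $S=\emptyset$, or: $C_j\not\subseteq S$ for all $j\in[k_2]$; $1\le u\le v\le k_2-t+1$; and, if $t=2$, additionally $u+v=k_2$. For a minimal nonempty $S$, let $\mathcal C(S)$ be the union of all $C_j$ with $C_j\cap S=\emptyset$, let $J_S$ be the ideal generated by $$\bigcup_{j\in[k_2],\,C_j\cap S=\emptyset}F_2(X_{C_j})\cup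 F_{t-1}(X_{\mathcal C(S)})\cup F_t(X_{(R_1\setminus S)\cup\mathcal C(S)})\cup F_t(X_{(R_2\setminus S)\cup\mathcal C(S)}),$$ and let $I_S=I_1(X_S)+J_S$, where $I_1(X_S)$ is generated by the variables in the columns of $X$ indexed by $S$. *)

theory Defs
  imports
    "HOL-Library.Poly_Mapping"
    "HOL-Library.Set_Algebras"
    "HOL-Algebra.Ideal"
    "Jordan_Normal_Form.Determinant"
begin

type_synonym column = "nat \<times> nat"
type_synonym indet = "nat \<times> column"
type_synonym cpoly = "(indet \<Rightarrow>\<^sub>0 nat) \<Rightarrow>\<^sub>0 complex"

definition grid :: "nat \<Rightarrow> nat \<Rightarrow> column set" where
  "grid k1 k2 = {1..k1} \<times> {1..k2}"

definition x_var :: "nat \<Rightarrow> column \<Rightarrow> cpoly" where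
  "x_var i c = Poly_Mapping.single (Poly_Mapping.single (i, c) 1) 1"

text \<open>The type of polynomials has infinitely many indeterminates; the ring \<open>C[X]\<close> consists of the
  polynomials that only involve the entries of the \<open>d \<times> k1 k2\<close> matrix \<open>X\<close>.\<close>

definition CX :: "nat \<Rightarrow> nat \<Rightarrow> nat \<Rightarrow> cpoly ring" where
  "CX d k1 k2 =
    \<lparr>carrier = {p. \<forall>m\<in>Poly_Mapping.keys p. Poly_Mapping.keys m \<subseteq> {1..d} \<times> grid k1 k2},
     monoid.mult = (*), one = 1, ring.zero = 0, add = (+)\<rparr>"

text \<open>Rows and columns of a minor are listed increasingly, the columns in lexicographic order.
  Another order of the columns would change the minors only by a sign.\<close>

definition minors :: "nat \<Rightarrow> nat \<Rightarrow> column set \<Rightarrow> cpoly set" where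
  "minors d r U =
    {det (mat r r (\<lambda>(a, b). x_var (rows ! a) (cols ! b))) | rows cols.
       length rows = r \<and> sorted_wrt (<) rows \<and> set rows \<subseteq> {1..d} \<and>
       length cols = r \<and> sorted_wrt (\<lambda>c c'. (c, c') \<in> less_than <*lex*> less_than) cols \<and>
       set cols \<subseteq> U}"

definition minor_ideal :: "nat \<Rightarrow> nat \<Rightarrow> nat \<Rightarrow> nat \<Rightarrow> column set \<Rightarrow> cpoly set" where
  "minor_ideal d k1 k2 r U = Idl\<^bsub>CX d k1 k2\<^esub> (minors d r U)"

definition R_set :: "nat \<Rightarrow> nat \<Rightarrow> column set" where
  "R_set k2 i = {i} \<times> {1..k2}"

definition C_set :: "nat \<Rightarrow> nat \<Rightarrow> column set" where
  "C_set k1 j = {1..k1} \<times> {j}"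

text \<open>Sums of ideals are elementwise sums of sets.\<close>

definition I_empty :: "nat \<Rightarrow> nat \<Rightarrow> nat \<Rightarrow> nat \<Rightarrow> cpoly set" where
  "I_empty d k1 k2 t =
    minor_ideal d k1 k2 t (grid k1 k2) + (\<Sum>j\<in>{1..k2}. minor_ideal d k1 k2 2 (C_set k1 j))"

definition comb_type :: "nat \<Rightarrow> column set \<Rightarrow> nat \<times> nat" where
  "comb_type k2 S =
    (min (card (R_set k2 1 \<inter> S)) (card (R_set k2 2 \<inter> S)),
     max (card (R_set k2 1 \<inter> S)) (card (R_set k2 2 \<inter> S)))"

text \<open>The bound \<open>v \<le> k2 - t + 1\<close> is written without truncated subtraction.\<close>

definition minimal_set :: "nat \<Rightarrow> nat \<Rightarrow> column set \<Rightarrow> bool" where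
  "minimal_set k2 t S \<longleftrightarrow>
    S \<subseteq> grid 2 k2 \<and>
    (S = {} \<or>
     (\<forall>j\<in>{1..k2}. \<not> C_set 2 j \<subseteq> S) \<and>
     (case comb_type k2 S of (u, v) \<Rightarrow>
        1 \<le> u \<and> u \<le> v \<and> v + t \<le> k2 + 1 \<and> (t = 2 \<longrightarrow> u + v = k2)))"

definition free_columns :: "nat \<Rightarrow> column set \<Rightarrow> nat set" where
  "free_columns k2 S = {j\<in>{1..k2}. C_set 2 j \<inter> S = {}}"

definition CC :: "nat \<Rightarrow> column set \<Rightarrow> column set" where
  "CC k2 S = (\<Union>j\<in>free_columns k2 S. C_set 2 j)"

definition J_ideal :: "nat \<Rightarrow> nat \<Rightarrow> nat \<Rightarrow> column set \<Rightarrow> cpoly set" where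
  "J_ideal d k2 t S =
    (if S = {} then I_empty d 2 k2 t
     else Idl\<^bsub>CX d 2 k2\<^esub>
       ((\<Union>j\<in>free_columns k2 S. minors d 2 (C_set 2 j)) \<union>
        minors d (t - 1) (CC k2 S) \<union>
        minors d t ((R_set k2 1 - S) \<union> CC k2 S) \<union>
        minors d t ((R_set k2 2 - S) \<union> CC k2 S)))"

definition I_ideal :: "nat \<Rightarrow> nat \<Rightarrow> nat \<Rightarrow> column set \<Rightarrow> cpoly set" where
  "I_ideal d k2 t S =
    (if S = {} then I_empty d 2 k2 t
     else minor_ideal d 2 k2 1 S + J_ideal d k2 t S)"

definition radical_of :: "('a, 'b) ring_scheme \<Rightarrow> 'a set \<Rightarrow> 'a set" where
  "radical_of R I = {f \<in> carrier R. \<exists>n::nat. n > 0 \<and> f [^]\<^bsub>R\<^esub> n \<in> I}"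

definition radical_ideal :: "'a set \<Rightarrow> ('a, 'b) ring_scheme \<Rightarrow> bool" where
  "radical_ideal I R \<longleftrightarrow> ideal I R \<and> radical_of R I = I"

text \<open>The ideal \<open>Idl\<^bsub>CX d k1 k2\<^esub> S\<close> is the ideal generated by \<open>S\<close> only if \<open>S\<close> lies in the carrier; the
  following facts ensure this for all generating sets above.\<close>

lemma CX_add_closed:
  "p \<in> carrier (CX d k1 k2) \<Longrightarrow> q \<in> carrier (CX d k1 k2) \<Longrightarrow> p + q \<in> carrier (CX d k1 k2)"
  using Poly_Mapping.keys_add[of p q] by (auto simp: CX_def)

lemma CX_mult_closed:
  assumes "p \<in> carrier (CX d k1 k2)" "q \<in> carrier (CX d k1 k2)"
  shows "p * q \<in> carrier (CX d k1 k2)"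
proof -
  have "Poly_Mapping.keys m \<subseteq> {1..d} \<times> grid k1 k2" if "m \<in> Poly_Mapping.keys (p * q)" for m
  proof -
    obtain a b where ab: "m = a + b" "a \<in> Poly_Mapping.keys p" "b \<in> Poly_Mapping.keys q"
      using \<open>m \<in> Poly_Mapping.keys (p * q)\<close> Poly_Mapping.keys_mult[of p q] by auto
    then have "Poly_Mapping.keys a \<subseteq> {1..d} \<times> grid k1 k2" "Poly_Mapping.keys b \<subseteq> {1..d} \<times> grid k1 k2"
      using assms by (auto simp: CX_def)
    then show ?thesis
      using Poly_Mapping.keys_add[of a b] ab(1) by blast
  qed
  then show ?thesis
    by (simp add: CX_def)
qed

lemma CX_uminus_closed: "p \<in> carrier (CX d k1 k2) \<Longrightarrow> - p \<in> carrier (CX d k1 k2)"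
proof -
  have "Poly_Mapping.keys (- p) = Poly_Mapping.keys p"
    by (auto simp: Poly_Mapping.in_keys_iff)
  then show "p \<in> carrier (CX d k1 k2) \<Longrightarrow> - p \<in> carrier (CX d k1 k2)"
    by (simp add: CX_def)
qed

lemma CX_0: "0 \<in> carrier (CX d k1 k2)" and CX_1: "1 \<in> carrier (CX d k1 k2)"
  by (auto simp: CX_def)

lemma cring_CX: "cring (CX d k1 k2)"
proof -
  let ?R = "CX d k1 k2"
  have ops: "x \<otimes>\<^bsub>?R\<^esub> y = x * y" "x \<oplus>\<^bsub>?R\<^esub> y = x + y" "\<one>\<^bsub>?R\<^esub> = 1" "\<zero>\<^bsub>?R\<^esub> = 0" for x y
    by (simp_all add: CX_def)
  show ?thesis
  proof (rule cringI)
    show "abelian_group ?R"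
    proof (rule abelian_groupI)
      fix x assume "x \<in> carrier ?R"
      then show "\<exists>y\<in>carrier ?R. y \<oplus>\<^bsub>?R\<^esub> x = \<zero>\<^bsub>?R\<^esub>"
        by (intro bexI[of _ "- x"]) (auto simp: ops CX_uminus_closed)
    qed (auto simp: ops CX_add_closed CX_0 algebra_simps)
    show "Group.comm_monoid ?R"
      by (rule comm_monoidI) (auto simp: ops CX_mult_closed CX_1 algebra_simps)
  qed (auto simp: ops algebra_simps)
qed

lemma x_var_closed: "i \<in> {1..d} \<Longrightarrow> c \<in> grid k1 k2 \<Longrightarrow> x_var i c \<in> carrier (CX d k1 k2)"
  by (auto simp: CX_def x_var_def)

lemma CX_sum_closed:
  "(\<And>i. i \<in> A \<Longrightarrow> f i \<in> carrier (CX d k1 k2)) \<Longrightarrow> sum f A \<in> carrier (CX d k1 k2)"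
  by (induction A rule: infinite_finite_induct) (auto simp: CX_0 CX_add_closed)

lemma CX_prod_closed:
  "(\<And>i. i \<in> A \<Longrightarrow> f i \<in> carrier (CX d k1 k2)) \<Longrightarrow> prod f A \<in> carrier (CX d k1 k2)"
  by (induction A rule: infinite_finite_induct) (auto simp: CX_1 CX_mult_closed)

lemma minors_closed:
  assumes "U \<subseteq> grid k1 k2"
  shows "minors d r U \<subseteq> carrier (CX d k1 k2)"
proof
  fix p assume "p \<in> minors d r U"
  then obtain rows cols where
    p: "p = det (mat r r (\<lambda>(a, b). x_var (rows ! a) (cols ! b)))"
    and rows: "length rows = r" "set rows \<subseteq> {1..d}"
    and cols: "length cols = r" "set cols \<subseteq> U"
    unfolding minors_def by blast
  have entry: "x_var (rows ! a) (cols ! b) \<in> carrier (CX d k1 k2)" if "a < r" "b < r" for a b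
  proof (rule x_var_closed)
    show "rows ! a \<in> {1..d}"
      using rows that nth_mem[of a rows] by blast
    show "cols ! b \<in> grid k1 k2"
      using cols assms that nth_mem[of b cols] by blast
  qed
  have sgn: "signof \<pi> \<in> carrier (CX d k1 k2)" for \<pi>
    by (simp add: sign_def CX_1 CX_uminus_closed)
  have entry': "mat r r (\<lambda>(a, b). x_var (rows ! a) (cols ! b)) $$ (a, \<pi> a) \<in> carrier (CX d k1 k2)"
    if "\<pi> permutes {0..<r}" "a < r" for \<pi> a
    using entry[of a "\<pi> a"] permutes_in_image[OF that(1), of a] that(2) by simp
  show "p \<in> carrier (CX d k1 k2)"
    unfolding p det_def by (auto intro!: CX_sum_closed CX_mult_closed CX_prod_closed sgn entry' simp del: index_mat)
qed

lemma ideal_minor_ideal: "U \<subseteq> grid k1 k2 \<Longrightarrow> ideal (minor_ideal d k1 k2 r U) (CX d k1 k2)"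
  unfolding minor_ideal_def
  by (intro ring.genideal_ideal cring.axioms(1)[OF cring_CX] minors_closed)

end

theory Submission
  imports Defs "HOL-Library.Product_Lexorder" "HOL-Library.Countable"
begin

text \<open>All ideals in question are generated by minors: the 2-minors of the column blocks \<open>C\<^sub>l\<close>, larger
  minors of unions of blocks, and possibly some variables. Let \<open>J\<close> be such an ideal and \<open>V\<close> its set of
  zeros. The proof exhibits a set of monomials that spans the polynomial ring modulo \<open>J\<close> and is
  linearly independent on \<open>V\<close>. This implies that \<open>J\<close> is radical: if \<open>f ^ n \<in> J\<close> and \<open>f - g \<in> J\<close>, where \<open>g\<close>
  is a combination of these monomials, then \<open>f\<close> and therefore \<open>g\<close> vanish on \<open>V\<close>; so \<open>g = 0\<close> and \<open>f \<in> J\<close>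
  (\<open>radical_block_ideal\<close>).

  To find the monomials, arrange the columns in such a way that each block and each of the other column
  sets is an interval, let \<open>pos c\<close> be the position of the column \<open>c\<close>, and give the variable in row \<open>i\<close> and
  column \<open>c\<close> the weight \<open>i * pos c\<close>. By the rearrangement inequality the diagonal product is the
  unique heaviest term of a minor. Replacing it by the other terms as long as possible shows that the
  monomials whose support contains no diagonal of a generator span modulo \<open>J\<close> (\<open>poly_reduction\<close>).

  For their independence on \<open>V\<close> (\<open>good_polys_independent\<close>), let \<open>g\<close> be a nonzero combination of them.
  Perturb the weights generically to real numbers \<open>w e\<close>, so that \<open>g\<close> has a unique heaviest monomial, of
  weight \<open>W\<close>, say, with support \<open>F\<close>. It suffices to find points \<open>x \<tau>\<close> of \<open>V\<close>, for real \<open>\<tau>\<close>, such that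
  \<open>x \<tau> e / exp (w e * \<tau>)\<close> tends to 1 for \<open>e \<in> F\<close> and to 0 for the other \<open>e\<close> as \<open>\<tau>\<close> grows: then
  \<open>g (x \<tau>) / exp (W * \<tau>)\<close> tends to the coefficient of the heaviest monomial and is not always zero.

  The points \<open>x \<tau>\<close> are constructed in \<open>arc_exists\<close>. A set of entries without a diagonal of length 2 is a
  staircase, and for it a rank-one matrix \<open>exp (\<tau> * (a i + b c))\<close> with the required growth exists because
  the weights are supermodular (\<open>staircase_potential\<close>). This settles the single blocks and leaves a matrix
  \<open>Y\<close> with one column for each block, in which the set \<open>D\<close> of prescribed entries has no
  diagonals of certain lengths within certain intervals of columns. By Dilworth's theorem \<open>D\<close> is a
  disjoint union of staircases, sufficiently few of which meet each of these intervals
  (\<open>staircase_partition\<close>). The sum of their rank-one matrices is \<open>Y\<close>.\<close>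

section \<open>Determinants, staircases and Dilworth's theorem\<close>

text \<open>A sum of fewer than \<open>r\<close> matrices of rank one has no nonzero \<open>r\<close>-minor: it factors through a
  space of dimension below \<open>r\<close>. Padding both factors to size \<open>r\<close> leaves a zero row in the right one.\<close>

lemma det_low_rank:
  fixes P Q :: "'k \<Rightarrow> nat \<Rightarrow> 'a::comm_ring_1"
  assumes "finite K" "card K < r"
  shows "det (mat r r (\<lambda>(a, b). \<Sum>k\<in>K. P k a * Q k b)) = 0"
proof -
  define n where "n = card K"
  obtain f where f: "bij_betw f {0..<n} K"
    using ex_bij_betw_nat_finite[OF assms(1)] n_def by blast
  define A where "A = mat r r (\<lambda>(a, k). if k < n then P (f k) a else 0)"
  define B where "B = mat r r (\<lambda>(k, b). if k < n then Q (f k) b else 0)"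
  have carr: "A \<in> carrier_mat r r" "B \<in> carrier_mat r r"
    by (auto simp: A_def B_def)
  have "mat r r (\<lambda>(a, b). \<Sum>k\<in>K. P k a * Q k b) = A * B"
  proof (rule eq_matI)
    fix a b assume ab: "a < dim_row (A * B)" "b < dim_col (A * B)"
    have "(A * B) $$ (a, b) = (\<Sum>k\<in>{0..<r}. if k < n then P (f k) a * Q (f k) b else 0)"
      using ab by (auto simp: A_def B_def scalar_prod_def intro!: sum.cong)
    also have "\<dots> = (\<Sum>k\<in>{0..<n}. P (f k) a * Q (f k) b)"
      using assms(2) by (intro sum.mono_neutral_cong_right) (auto simp: n_def)
    also have "\<dots> = (\<Sum>k\<in>K. P k a * Q k b)"
      using sum.reindex_bij_betw[OF f, of "\<lambda>k. P k a * Q k b"] by simp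
    finally show "mat r r (\<lambda>(a, b). \<Sum>k\<in>K. P k a * Q k b) $$ (a, b) = (A * B) $$ (a, b)"
      using ab by (simp add: A_def B_def)
  qed (auto simp: A_def B_def)
  moreover have "det B = 0"
  proof -
    have "(\<Prod>i = 0..<r. B $$ (i, p i)) = 0" if "p permutes {0..<r}" for p
    proof (rule prod_zero)
      show "\<exists>i\<in>{0..<r}. B $$ (i, p i) = 0"
        using assms(2) permutes_in_image[OF that, of n]
        by (intro bexI[of _ n]) (auto simp: B_def n_def)
    qed simp
    then show ?thesis
      unfolding det_def'[OF carr(2)] by (intro sum.neutral) auto
  qed
  ultimately show ?thesis
    using det_mult[OF carr] by simp
qed

text \<open>This is the tropical form of a rank-one matrix: \<open>exp (\<tau> * (a i + b c))\<close> stays below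
  \<open>exp (\<tau> * w i c)\<close> everywhere and reaches it on the staircase \<open>G\<close>. A staircase crosses from row
  \<open>i\<close> to row \<open>i + 1\<close> at some column; taking there the increment of \<open>w\<close> as the increment of \<open>a\<close> makes
  \<open>w i c - a i\<close>, as a function of \<open>i\<close>, decrease up to the entries of \<open>G\<close> in column \<open>c\<close> and increase
  after them, because the increments of \<open>w\<close> grow with the position of the column. The last conclusion
  lets the increments of \<open>a\<close> inherit such growth when the potentials of several blocks are compared.\<close>

lemma staircase_potential:
  fixes w :: "nat \<Rightarrow> 'c \<Rightarrow> real" and pos :: "'c \<Rightarrow> nat"
  assumes C: "finite C" "C \<noteq> {}" and d: "1 \<le> d"
    and G: "G \<subseteq> {1..d} \<times> C"
    and stair: "\<And>i c i' c'. (i, c) \<in> G \<Longrightarrow> (i', c') \<in> G \<Longrightarrow> i < i' \<Longrightarrow> pos c' \<le> pos c"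
    and mono: "\<And>i c c'. 1 \<le> i \<Longrightarrow> i < d \<Longrightarrow> c \<in> C \<Longrightarrow> c' \<in> C \<Longrightarrow> pos c \<le> pos c' \<Longrightarrow>
                 w (Suc i) c - w i c \<le> w (Suc i) c' - w i c'"
  obtains a b where
    "\<And>i c. 1 \<le> i \<Longrightarrow> i \<le> d \<Longrightarrow> c \<in> C \<Longrightarrow> a i + b c \<le> w i c"
    "\<And>i c. (i, c) \<in> G \<Longrightarrow> a i + b c = w i c"
    "\<And>i. 1 \<le> i \<Longrightarrow> i < d \<Longrightarrow> \<exists>c\<in>C. a (Suc i) - a i = w (Suc i) c - w i c"
proof -
  \<comment> \<open>the column in which \<open>G\<close> passes from the rows up to \<open>h\<close> to the rows below\<close>
  have "\<exists>c\<in>C. (\<forall>(i', c')\<in>G. h < i' \<longrightarrow> pos c' \<le> pos c) \<and> (\<forall>(i', c')\<in>G. i' \<le> h \<longrightarrow> pos c \<le> pos c')" for h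
  proof (cases "\<exists>(i', c')\<in>G. h < i'")
    case True
    define D where "D = {c'. \<exists>i'. (i', c') \<in> G \<and> h < i'}"
    have D: "finite D" "D \<noteq> {}" "D \<subseteq> C"
      using True G C by (auto simp: D_def intro: finite_subset[of _ C])
    obtain c where c: "c \<in> D" "\<And>c'. c' \<in> D \<Longrightarrow> pos c' \<le> pos c"
      using finite_has_maximal[of "pos ` D"] D by fastforce
    then obtain i where "(i, c) \<in> G" "h < i"
      by (auto simp: D_def)
    have "pos c' \<le> pos c" if "(i', c') \<in> G" "h < i'" for i' c'
      using that by (intro c(2)) (auto simp: D_def)
    moreover have "pos c \<le> pos c'" if "(i', c') \<in> G" "i' \<le> h" for i' c'
      using that stair[of i' c' i c] \<open>(i, c) \<in> G\<close> \<open>h < i\<close> by simp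
    ultimately show ?thesis
      using c D by (intro bexI[of _ c]) auto
  next
    case False
    obtain c where c: "c \<in> C" "\<And>c'. c' \<in> C \<Longrightarrow> pos c \<le> pos c'"
      using finite_has_minimal[of "pos ` C"] C by fastforce
    then show ?thesis
      using False G by (intro bexI[of _ c]) auto
  qed
  then obtain t where t: "\<And>h. t h \<in> C"
      "\<And>h i c. (i, c) \<in> G \<Longrightarrow> h < i \<Longrightarrow> pos c \<le> pos (t h)"
      "\<And>h i c. (i, c) \<in> G \<Longrightarrow> i \<le> h \<Longrightarrow> pos (t h) \<le> pos c"
    by (metis (no_types, lifting) case_prodD)
  define a where "a i = (\<Sum>h\<in>{1..<i}. w (Suc h) (t h) - w h (t h))" for i
  define b where "b c = Min ((\<lambda>i. w i c - a i) ` {1..d})" for c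
  have a_Suc: "a (Suc i) - a i = w (Suc i) (t i) - w i (t i)" if "1 \<le> i" for i
    using that by (simp add: a_def)
  show ?thesis
  proof
    fix i c assume "1 \<le> i" "i \<le> d" "c \<in> C"
    then have "b c \<le> w i c - a i"
      unfolding b_def by (intro Min_le) auto
    then show "a i + b c \<le> w i c" by simp
  next
    fix i c assume ic: "(i, c) \<in> G"
    then have i: "1 \<le> i" "i \<le> d" and c: "c \<in> C"
      using G by auto
    have up: "w i c - a i \<le> w i' c - a i'" if "i \<le> i'" "i' \<le> d" for i'
      using that
    proof (induction i' rule: dec_induct)
      case (step h)
      have "w (Suc h) (t h) - w h (t h) \<le> w (Suc h) c - w h c"
        using step i by (intro mono t(1) c t(3)[OF ic]) auto
      then show ?case
        using step a_Suc[of h] i by force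
    qed simp
    have down: "w i c - a i \<le> w i' c - a i'" if "i' \<le> i" "1 \<le> i'" for i'
      using that
    proof (induction i' rule: inc_induct)
      case (step h)
      have "w (Suc h) c - w h c \<le> w (Suc h) (t h) - w h (t h)"
        using step i by (intro mono t(1) c t(2)[OF ic]) auto
      then show ?case
        using step a_Suc[of h] by force
    qed simp
    have "b c = w i c - a i"
      unfolding b_def
    proof (rule Min_eqI)
      fix y assume "y \<in> (\<lambda>i. w i c - a i) ` {1..d}"
      then obtain i' where "y = w i' c - a i'" "1 \<le> i'" "i' \<le> d" by auto
      then show "w i c - a i \<le> y"
        using up[of i'] down[of i'] by (cases "i \<le> i'") auto
    next
      show "w i c - a i \<in> (\<lambda>i. w i c - a i) ` {1..d}"
        using i by (intro imageI) simp
    qed simp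
    then show "a i + b c = w i c" by simp
  next
    fix i :: nat assume "1 \<le> i" "i < d"
    then show "\<exists>c\<in>C. a (Suc i) - a i = w (Suc i) c - w i c"
      using a_Suc t(1) by blast
  qed
qed

text \<open>Dilworth's theorem, with the covering chains as colour classes. The induction is Galvin's: remove
  a maximal element \<open>a\<close>, colour the rest with \<open>k\<close> chains, where \<open>k\<close> is its width, and let \<open>top i\<close> be
  the largest element of colour \<open>i\<close> that lies in an antichain of size \<open>k\<close>. The elements \<open>top i\<close> form an
  antichain. If \<open>a\<close> is incomparable to all of them, the width is larger than \<open>k\<close> and \<open>a\<close> may have a
  colour of its own; otherwise \<open>a\<close> extends the part of a colour class below some \<open>top i\<close>, and
  this chain meets every antichain of size \<open>k\<close>, so that the induction hypothesis colours the rest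
  with \<open>k - 1\<close> chains.\<close>

lemma dilworth:
  fixes le :: "'a \<Rightarrow> 'a \<Rightarrow> bool"
  assumes "finite P"
    and refl: "\<And>x. x \<in> P \<Longrightarrow> le x x"
    and trans: "\<And>x y z. x \<in> P \<Longrightarrow> y \<in> P \<Longrightarrow> z \<in> P \<Longrightarrow> le x y \<Longrightarrow> le y z \<Longrightarrow> le x z"
    and antisym: "\<And>x y. x \<in> P \<Longrightarrow> y \<in> P \<Longrightarrow> le x y \<Longrightarrow> le y x \<Longrightarrow> x = y"
    and width: "\<And>A. A \<subseteq> P \<Longrightarrow> (\<forall>x\<in>A. \<forall>y\<in>A. le x y \<longrightarrow> x = y) \<Longrightarrow> card A \<le> n"
  shows "\<exists>c. (\<forall>x\<in>P. c x < n) \<and> (\<forall>x\<in>P. \<forall>y\<in>P. c x = c y \<longrightarrow> le x y \<or> le y x)"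
  using assms
proof (induction "card P" arbitrary: P n rule: less_induct)
  case less
  define anti where "anti A \<longleftrightarrow> (\<forall>x\<in>A. \<forall>y\<in>A. le x y \<longrightarrow> x = y)" for A
  define colored where "colored P n c \<longleftrightarrow> (\<forall>x\<in>P. c x < n) \<and> (\<forall>x\<in>P. \<forall>y\<in>P. c x = c y \<longrightarrow> le x y \<or> le y x)"
    for P n and c :: "'a \<Rightarrow> nat"
  have IH: "\<exists>c. colored P' n' c" if "P' \<subset> P" "\<And>A. A \<subseteq> P' \<Longrightarrow> anti A \<Longrightarrow> card A \<le> n'" for P' n'
    unfolding colored_def
    using that less.prems(1) psubset_card_mono[OF less.prems(1) that(1)]
    by (intro less.hyps)
      (auto simp: anti_def finite_subset intro: less.prems(2,4) dest: less.prems(3)[rotated 3])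
  show ?case
  proof (cases "P = {}")
    case False
    have maxi: "\<exists>a\<in>D. \<forall>x\<in>D. le a x \<longrightarrow> x = a" if "D \<subseteq> P" "D \<noteq> {}" for D
    proof -
      have "finite D" using that less.prems(1) finite_subset by blast
      then show ?thesis
        using that(2,1)
      proof (induction D rule: finite_ne_induct)
        case (insert y D)
        then obtain a where a: "a \<in> D" "\<forall>x\<in>D. le a x \<longrightarrow> x = a" by auto
        show ?case
        proof (cases "le a y")
          case True
          then show ?thesis
            using a insert.prems less.prems(3)[of a y] less.prems(4)
            by (intro bexI[of _ y]) (auto, metis subsetD)
        next
          case False
          then show ?thesis using a by auto
        qed
      qed auto
    qed
    obtain a where a: "a \<in> P" "\<forall>x\<in>P. le a x \<longrightarrow> x = a"
      using maxi[of P] False by auto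
    define P' where "P' = P - {a}"
    have P': "P' \<subset> P" "finite P'" using a less.prems(1) by (auto simp: P'_def)
    define S where "S = {A. A \<subseteq> P' \<and> anti A}"
    have S: "finite S" "S \<noteq> {}" using P' by (auto simp: S_def anti_def)
    define k where "k = Max (card ` S)"
    have k_max: "card A \<le> k" if "A \<subseteq> P'" "anti A" for A
      using that S by (auto simp: k_def S_def)
    obtain A0 where A0: "A0 \<subseteq> P'" "anti A0" "card A0 = k"
    proof -
      have "k \<in> card ` S"
        unfolding k_def using S by (intro Max_in) auto
      then show thesis using that by (auto simp: S_def)
    qed
    have kn: "k \<le> n"
      using less.prems(5)[of A0] A0 P' by (auto simp: anti_def)
    obtain c where c: "colored P' k c"
      using IH[OF P'(1) k_max] by blast
    have transversal: "\<exists>x\<in>A. c x = i" if "A \<subseteq> P'" "anti A" "card A = k" "i < k" for A i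
    proof -
      have "inj_on c A"
      proof (rule inj_onI)
        fix x y assume xy: "x \<in> A" "y \<in> A" "c x = c y"
        then have "le x y \<or> le y x" using that(1) c unfolding colored_def by blast
        then show "x = y" using xy that(2) unfolding anti_def by blast
      qed
      then have "card (c ` A) = k" using that card_image by blast
      moreover have "c ` A \<subseteq> {..<k}" using that c by (auto simp: colored_def)
      ultimately have "c ` A = {..<k}"
        by (intro card_subset_eq) auto
      then have "i \<in> c ` A" using that(4) by simp
      then show ?thesis by blast
    qed
    define M where "M i = {x \<in> P'. c x = i \<and> (\<exists>A \<subseteq> P'. anti A \<and> card A = k \<and> x \<in> A)}" for i
    have "\<exists>x\<in>M i. \<forall>y\<in>M i. le y x" if "i < k" for i
    proof -
      have "M i \<noteq> {}"
        using transversal[OF A0 that] A0 unfolding M_def by blast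
      then obtain x where x: "x \<in> M i" "\<forall>y\<in>M i. le x y \<longrightarrow> y = x"
        using maxi[of "M i"] P'(1) unfolding M_def by blast
      have "le y x" if y: "y \<in> M i" for y
      proof -
        have "le x y \<or> le y x"
          using x(1) y c unfolding M_def colored_def by blast
        moreover have "le x x"
          using x(1) P'(1) less.prems(2)[of x] unfolding M_def by blast
        ultimately show ?thesis using x(2) y by blast
      qed
      then show ?thesis using x by blast
    qed
    then obtain top where top: "\<And>i. i < k \<Longrightarrow> top i \<in> M i" "\<And>i y. i < k \<Longrightarrow> y \<in> M i \<Longrightarrow> le y (top i)"
      by metis
    have top_P: "top i \<in> P'" "c (top i) = i" if "i < k" for i
      using top(1)[OF that] by (auto simp: M_def)
    have incomp: "\<not> le (top j) (top i)" if ij: "i < k" "j < k" "i \<noteq> j" for i j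
    proof
      assume le: "le (top j) (top i)"
      obtain A where A: "A \<subseteq> P'" "anti A" "card A = k" "top i \<in> A"
        using top(1)[OF ij(1)] unfolding M_def by blast
      obtain y where y: "y \<in> A" "c y = j"
        using transversal[OF A(1-3) ij(2)] by blast
      then have "le y (top j)"
        using A by (intro top(2) ij) (unfold M_def, blast)
      then have "le y (top i)"
        using le less.prems(3)[of y "top j" "top i"] y A top_P(1)[OF ij(1)] top_P(1)[OF ij(2)] P'(1)
        by blast
      then have "y = top i" using A y unfolding anti_def by blast
      then show False using y top_P(2)[OF ij(1)] ij by simp
    qed
    show ?thesis
    proof (cases "\<exists>i<k. le (top i) a")
      case False
      define A where "A = insert a (top ` {..<k})"
      have "inj_on top {..<k}"
        using top_P by (intro inj_on_inverseI[of _ c]) auto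
      moreover have "a \<notin> top ` {..<k}" using top_P by (auto simp: P'_def)
      ultimately have "card A = Suc k"
        by (simp add: A_def card_image)
      moreover have "anti A"
      proof -
        have "x = y" if xy: "x \<in> A" "y \<in> A" "le x y" for x y
        proof (cases "x = a")
          case True
          have "y \<in> P" using xy(2) a(1) top_P(1) P'(1) unfolding A_def by blast
          then show ?thesis using a(2) True xy(3) by blast
        next
          case x: False
          then obtain i where i: "i < k" "x = top i" using xy(1) unfolding A_def by blast
          show ?thesis
          proof (cases "y = a")
            case True
            then show ?thesis using \<open>\<not> (\<exists>i<k. le (top i) a)\<close> i xy(3) by blast
          next
            case False
            then obtain j where "j < k" "y = top j" using xy(2) unfolding A_def by blast
            then show ?thesis using incomp[of j i] i xy(3) by blast
          qed
        qed
        then show ?thesis unfolding anti_def by blast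
      qed
      moreover have "A \<subseteq> P" using a top_P P'(1) by (auto simp: A_def)
      ultimately have "k < n" using less.prems(5)[of A] unfolding anti_def by force
      have "colored P n (c(a := k))"
        unfolding colored_def
      proof (intro conjI ballI impI)
        fix x assume "x \<in> P"
        then show "(c(a := k)) x < n"
          using c \<open>k < n\<close> unfolding colored_def P'_def by (cases "x = a") force+
      next
        fix x y assume xy: "x \<in> P" "y \<in> P" "(c(a := k)) x = (c(a := k)) y"
        have less: "c z < k" if "z \<in> P" "z \<noteq> a" for z
          using that c unfolding colored_def P'_def by blast
        show "le x y \<or> le y x"
        proof (cases "x = a \<or> y = a")
          case True
          then have "x = a \<and> y = a" using xy less by (metis fun_upd_apply less_irrefl)
          then show ?thesis using less.prems(2)[OF a(1)] by simp
        next
          case False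
          then show ?thesis using xy c unfolding colored_def P'_def by simp
        qed
      qed
      then show ?thesis unfolding colored_def by blast
    next
      case True
      then obtain i where i: "i < k" "le (top i) a" by blast
      define K where "K = insert a {z \<in> P'. c z = i \<and> le z (top i)}"
      have K: "K \<subseteq> P" "a \<in> K" using a P' by (auto simp: K_def)
      have "card A \<le> k - 1" if A: "A \<subseteq> P - K" "anti A" for A
      proof -
        have AP: "A \<subseteq> P'" using A by (auto simp: P'_def K_def)
        have "card A \<noteq> k"
        proof
          assume card: "card A = k"
          obtain z where z: "z \<in> A" "c z = i"
            using transversal[OF AP A(2) card i(1)] by blast
          have "z \<in> M i" using AP A(2) card z unfolding M_def by blast
          then have "le z (top i)" using top(2) i(1) by blast
          then show False using z AP A(1) unfolding K_def by blast
        qed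
        then show ?thesis using k_max[OF AP A(2)] by linarith
      qed
      then obtain e where e: "colored (P - K) (k - 1) e"
        using IH[of "P - K"] K by blast
      have chain: "le x y \<or> le y x" if "x \<in> K" "y \<in> K" for x y
      proof -
        have "le x a" if "x \<in> K" for x
          using that i(2) less.prems(2)[OF a(1)] less.prems(3)[of x "top i" a] a(1) top_P(1)[OF i(1)] P'(1)
          unfolding K_def by blast
        then show ?thesis
          using that c unfolding K_def colored_def by blast
      qed
      have "colored P n (\<lambda>x. if x \<in> K then k - 1 else e x)"
        unfolding colored_def
      proof (intro conjI ballI impI)
        fix x assume "x \<in> P"
        then have "x \<notin> K \<Longrightarrow> e x < k - 1" using e unfolding colored_def by blast
        then show "(if x \<in> K then k - 1 else e x) < n"
          using kn i(1) by (cases "x \<in> K") auto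
      next
        fix x y assume xy: "x \<in> P" "y \<in> P"
          "(if x \<in> K then k - 1 else e x) = (if y \<in> K then k - 1 else e y)"
        have less: "e z < k - 1" if "z \<in> P" "z \<notin> K" for z
          using that e unfolding colored_def by blast
        consider "x \<in> K" "y \<in> K" | "x \<notin> K" "y \<notin> K"
          using xy less[of x] less[of y] by (cases "x \<in> K"; cases "y \<in> K") auto
        then show "le x y \<or> le y x"
        proof cases
          case 2
          then show ?thesis using xy e unfolding colored_def by simp
        qed (use chain in blast)
      qed
      then show ?thesis unfolding colored_def
        by (rule exI[of _ "\<lambda>x. if x \<in> K then k - 1 else e x"])
    qed
  qed auto
qed

section \<open>Evaluation of polynomials and reduction modulo minors\<close>

definition eval_monom :: "('v \<Rightarrow> complex) \<Rightarrow> ('v \<Rightarrow>\<^sub>0 nat) \<Rightarrow> complex" where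
  "eval_monom x m = (\<Prod>v\<in>Poly_Mapping.keys m. x v ^ Poly_Mapping.lookup m v)"

definition eval_poly :: "('v \<Rightarrow> complex) \<Rightarrow> (('v \<Rightarrow>\<^sub>0 nat) \<Rightarrow>\<^sub>0 complex) \<Rightarrow> complex" where
  "eval_poly x p = (\<Sum>m\<in>Poly_Mapping.keys p. Poly_Mapping.lookup p m * eval_monom x m)"

lemma eval_monom_superset:
  "finite A \<Longrightarrow> Poly_Mapping.keys m \<subseteq> A \<Longrightarrow> eval_monom x m = (\<Prod>v\<in>A. x v ^ Poly_Mapping.lookup m v)"
  unfolding eval_monom_def by (intro prod.mono_neutral_left) (auto simp: in_keys_iff)

lemma eval_poly_superset:
  "finite A \<Longrightarrow> Poly_Mapping.keys p \<subseteq> A \<Longrightarrow>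
    eval_poly x p = (\<Sum>m\<in>A. Poly_Mapping.lookup p m * eval_monom x m)"
  unfolding eval_poly_def by (intro sum.mono_neutral_left) (auto simp: in_keys_iff)

lemma eval_monom_add: "eval_monom x (a + b) = eval_monom x a * eval_monom x b"
proof -
  let ?A = "Poly_Mapping.keys a \<union> Poly_Mapping.keys b"
  have "Poly_Mapping.keys (a + b) \<subseteq> ?A" by (rule keys_add)
  then show ?thesis
    by (simp add: eval_monom_superset[of ?A] lookup_add power_add prod.distrib)
qed

lemma eval_poly_add: "eval_poly x (p + q) = eval_poly x p + eval_poly x q"
proof -
  let ?A = "Poly_Mapping.keys p \<union> Poly_Mapping.keys q"
  have "Poly_Mapping.keys (p + q) \<subseteq> ?A" by (rule keys_add)
  then show ?thesis
    by (simp add: eval_poly_superset[of ?A] lookup_add distrib_right sum.distrib)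
qed

lemma eval_poly_zero [simp]: "eval_poly x 0 = 0"
  by (simp add: eval_poly_def)

lemma eval_poly_single [simp]: "eval_poly x (Poly_Mapping.single m c) = c * eval_monom x m"
  by (cases "c = 0") (auto simp: eval_poly_def)

lemma eval_poly_sum: "eval_poly x (\<Sum>i\<in>A. f i) = (\<Sum>i\<in>A. eval_poly x (f i))"
  by (induction A rule: infinite_finite_induct) (auto simp: eval_poly_add)

lemma poly_sum_singles:
  "(\<Sum>m\<in>Poly_Mapping.keys p. Poly_Mapping.single m (Poly_Mapping.lookup p m)) = p"
proof (rule poly_mapping_eqI)
  fix k
  have "Poly_Mapping.lookup (\<Sum>m\<in>Poly_Mapping.keys p. Poly_Mapping.single m (Poly_Mapping.lookup p m)) k
      = (\<Sum>m\<in>Poly_Mapping.keys p. if m = k then Poly_Mapping.lookup p m else 0)"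
    by (auto simp: lookup_sum lookup_single when_def intro!: sum.cong)
  also have "\<dots> = Poly_Mapping.lookup p k"
    by (simp add: in_keys_iff)
  finally show "Poly_Mapping.lookup (\<Sum>m\<in>Poly_Mapping.keys p. Poly_Mapping.single m (Poly_Mapping.lookup p m)) k
      = Poly_Mapping.lookup p k" .
qed

lemma eval_poly_mult: "eval_poly x (p * q) = eval_poly x p * eval_poly x q"
proof -
  have "p * q = (\<Sum>m\<in>Poly_Mapping.keys p. \<Sum>n\<in>Poly_Mapping.keys q.
      Poly_Mapping.single (m + n) (Poly_Mapping.lookup p m * Poly_Mapping.lookup q n))"
    by (subst poly_sum_singles[of p, symmetric], subst poly_sum_singles[of q, symmetric])
      (simp add: sum_product mult_single)
  then have "eval_poly x (p * q) = (\<Sum>m\<in>Poly_Mapping.keys p. \<Sum>n\<in>Poly_Mapping.keys q.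
      Poly_Mapping.lookup p m * Poly_Mapping.lookup q n * (eval_monom x m * eval_monom x n))"
    by (simp add: eval_poly_sum eval_monom_add)
  then show ?thesis
    by (simp add: eval_poly_def sum_product algebra_simps)
qed

lemma eval_poly_one [simp]: "eval_poly x 1 = 1"
  by (simp add: eval_poly_def eval_monom_def)

lemma comm_ring_hom_eval_poly: "comm_ring_hom (eval_poly x)"
  by standard (auto simp: eval_poly_add eval_poly_mult)

lemma eval_poly_x_var [simp]: "eval_poly x (x_var i c) = x (i, c)"
  by (simp add: x_var_def eval_monom_def)

lemma eval_poly_minor:
  "eval_poly x (det (mat r r (\<lambda>(a, b). x_var (rs ! a) (cs ! b)))) =
    det (mat r r (\<lambda>(a, b). x (rs ! a, cs ! b)))"
proof -
  interpret comm_ring_hom "eval_poly x" by (rule comm_ring_hom_eval_poly)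
  have "map_mat (eval_poly x) (mat r r (\<lambda>(a, b). x_var (rs ! a) (cs ! b))) =
      mat r r (\<lambda>(a, b). x (rs ! a, cs ! b))"
    by (intro eq_matI) auto
  then show ?thesis by (metis hom_det)
qed

definition weight :: "(column \<Rightarrow> nat) \<Rightarrow> (indet \<Rightarrow>\<^sub>0 nat) \<Rightarrow> nat" where
  "weight pos m = (\<Sum>v\<in>Poly_Mapping.keys m. Poly_Mapping.lookup m v * (fst v * pos (snd v)))"

lemma weight_add: "weight pos (a + b) = weight pos a + weight pos b"
proof -
  let ?A = "Poly_Mapping.keys a \<union> Poly_Mapping.keys b"
  have sup: "weight pos m = (\<Sum>v\<in>?A. Poly_Mapping.lookup m v * (fst v * pos (snd v)))"
    if "Poly_Mapping.keys m \<subseteq> ?A" for m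
    unfolding weight_def using that by (intro sum.mono_neutral_left) (auto simp: in_keys_iff)
  have "Poly_Mapping.keys (a + b) \<subseteq> ?A" by (rule keys_add)
  then show ?thesis
    by (simp add: sup lookup_add distrib_right sum.distrib)
qed

lemma weight_sum: "weight pos (\<Sum>i\<in>A. f i) = (\<Sum>i\<in>A. weight pos (f i))"
  by (induction A rule: infinite_finite_induct) (auto simp: weight_add, auto simp: weight_def)

lemma weight_single: "weight pos (Poly_Mapping.single (i, c) 1) = i * pos c"
  by (simp add: weight_def)

text \<open>Exchanging the two values of an inversion increases the sum, so only the identity can
  attain the maximum over all permutations. For the weights below it says that the diagonal product is
  the unique heaviest term of a minor.\<close>

lemma rearrangement_strict:
  fixes u v :: "nat \<Rightarrow> nat"
  assumes u: "\<And>a b. a < b \<Longrightarrow> b < r \<Longrightarrow> u a < u b" and v: "\<And>a b. a < b \<Longrightarrow> b < r \<Longrightarrow> v a < v b"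
    and \<pi>: "\<pi> permutes {0..<r}" "\<pi> \<noteq> id"
  shows "(\<Sum>a\<in>{0..<r}. u a * v (\<pi> a)) < (\<Sum>a\<in>{0..<r}. u a * v a)"
proof -
  define f where "f \<sigma> = (\<Sum>a\<in>{0..<r}. u a * v (\<sigma> a))" for \<sigma>
  have improve: "\<exists>\<sigma>'. \<sigma>' permutes {0..<r} \<and> f \<sigma> < f \<sigma>'" if \<sigma>: "\<sigma> permutes {0..<r}" "\<sigma> \<noteq> id" for \<sigma>
  proof -
    obtain i where i: "\<sigma> i < i" "i < r"
      using permutes_natset_ge[OF \<sigma>(1)] \<sigma> by (metis atLeastLessThan_iff leI permutes_not_in less_irrefl)
    have "\<exists>a<i. i \<le> \<sigma> a"
    proof (rule ccontr)
      assume "\<not> ?thesis"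
      then have "\<sigma> a < i" if "a \<le> i" for a
        using i(1) that by (cases "a = i") (auto simp: not_le)
      then have "\<sigma> ` {0..i} \<subseteq> {0..<i}"
        by auto
      moreover have "inj_on \<sigma> {0..i}" using permutes_inj_on[OF \<sigma>(1)] .
      ultimately have "card {0..i} \<le> card {0..<i}"
        by (intro card_inj_on_le) auto
      then show False by simp
    qed
    then obtain h where h: "h < i" "i \<le> \<sigma> h" by blast
    define \<sigma>' where "\<sigma>' = \<sigma> \<circ> Transposition.transpose h i"
    have "\<sigma>' permutes {0..<r}"
      unfolding \<sigma>'_def using \<sigma> h i by (intro permutes_compose permutes_swap_id) auto
    moreover have "f \<sigma> < f \<sigma>'"
    proof -
      have split: "f \<tau> = u h * v (\<tau> h) + (u i * v (\<tau> i) + (\<Sum>a\<in>{0..<r} - {h} - {i}. u a * v (\<tau> a)))" for \<tau>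
        unfolding f_def using h i
        by (subst sum.remove[of _ h], simp, simp, subst sum.remove[of _ i]) auto
      have rest: "(\<Sum>a\<in>{0..<r} - {h} - {i}. u a * v (\<sigma>' a)) = (\<Sum>a\<in>{0..<r} - {h} - {i}. u a * v (\<sigma> a))"
        by (intro sum.cong) (auto simp: \<sigma>'_def transpose_apply_other)
      obtain p where p: "u i = u h + p" "0 < p"
        using u[of h i] h i less_imp_add_positive by metis
      have "\<sigma> h < r" using permutes_in_image[OF \<sigma>(1), of h] h i by simp
      then obtain q where q: "v (\<sigma> h) = v (\<sigma> i) + q" "0 < q"
        using v[of "\<sigma> i" "\<sigma> h"] h i less_imp_add_positive by (metis less_le_trans)
      have "\<sigma>' h = \<sigma> i" "\<sigma>' i = \<sigma> h" by (auto simp: \<sigma>'_def)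
      then show ?thesis
        unfolding split[of \<sigma>] split[of \<sigma>'] rest using p q by (simp add: algebra_simps)
    qed
    ultimately show ?thesis by blast
  qed
  have fin: "finite (f ` {\<sigma>. \<sigma> permutes {0..<r}})"
    by (simp add: finite_permutations)
  have ne: "f ` {\<sigma>. \<sigma> permutes {0..<r}} \<noteq> {}" using permutes_id by blast
  obtain \<sigma> where \<sigma>: "\<sigma> permutes {0..<r}" "f \<sigma> = Max (f ` {\<sigma>. \<sigma> permutes {0..<r}})"
    using Max_in[OF fin ne] by auto
  have max: "f \<tau> \<le> f \<sigma>" if "\<tau> permutes {0..<r}" for \<tau>
    unfolding \<sigma>(2) using that fin by (intro Max_ge) auto
  have "\<sigma> = id" using improve[OF \<sigma>(1)] max by (meson leD)
  moreover obtain \<tau> where "\<tau> permutes {0..<r}" "f \<pi> < f \<tau>" using improve[OF \<pi>] by blast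
  ultimately have "f \<pi> < f id" using max by (metis le_less_trans less_le_trans)
  then show ?thesis by (simp add: f_def)
qed

lemma ideal_CX_closed:
  assumes "ideal J (CX d k1 k2)"
  shows "J \<subseteq> carrier (CX d k1 k2)" "0 \<in> J" "p \<in> J \<Longrightarrow> q \<in> J \<Longrightarrow> p + q \<in> J"
    "p \<in> J \<Longrightarrow> q \<in> carrier (CX d k1 k2) \<Longrightarrow> q * p \<in> J" "p \<in> J \<Longrightarrow> - p \<in> J"
    "p \<in> J \<Longrightarrow> q \<in> J \<Longrightarrow> p - q \<in> J"
proof -
  interpret ideal J "CX d k1 k2" by fact
  have ops: "x \<otimes>\<^bsub>CX d k1 k2\<^esub> y = x * y" "x \<oplus>\<^bsub>CX d k1 k2\<^esub> y = x + y" "\<zero>\<^bsub>CX d k1 k2\<^esub> = 0" for x y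
    by (simp_all add: CX_def)
  show 1: "J \<subseteq> carrier (CX d k1 k2)" using a_subset .
  show "0 \<in> J" using additive_subgroup.zero_closed[OF additive_subgroup_axioms] by (simp add: ops)
  show add: "p + q \<in> J" if "p \<in> J" "q \<in> J" for p q
    using additive_subgroup.a_closed[OF additive_subgroup_axioms] that by (simp add: ops)
  show mult: "q * p \<in> J" if "p \<in> J" "q \<in> carrier (CX d k1 k2)" for p q
    using I_l_closed[of p q] that by (simp add: ops)
  show neg: "- p \<in> J" if "p \<in> J" for p
    using mult[OF that CX_uminus_closed[OF CX_1]] by simp
  show "p - q \<in> J" if "p \<in> J" "q \<in> J" for p q
    using add[OF that(1) neg[OF that(2)]] by simp
qed

lemma ideal_CX_sum:
  assumes "ideal J (CX d k1 k2)" "\<And>i. i \<in> A \<Longrightarrow> f i \<in> J"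
  shows "sum f A \<in> J"
  using assms(2) by (induction A rule: infinite_finite_induct)
    (simp_all add: ideal_CX_closed(2,3)[OF assms(1)])

lemma signof_cases: "signof \<pi> = (1 :: 'a :: comm_ring_1) \<or> signof \<pi> = (- 1 :: 'a)"
  by (simp add: sign_def)

text \<open>A chain of length \<open>r\<close> in \<open>F\<close> with columns in \<open>U\<close> is the diagonal of an \<open>r\<close>-minor of the columns
  \<open>U\<close>, all of whose entries lie in \<open>F\<close>. Columns are compared by \<open>pos\<close>, not lexicographically.\<close>

definition chain :: "(column \<Rightarrow> nat) \<Rightarrow> column set \<Rightarrow> indet set \<Rightarrow> nat list \<Rightarrow> column list \<Rightarrow> bool" where
  "chain pos U F rs cs \<longleftrightarrow> length rs = length cs \<and> sorted_wrt (<) rs \<and>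
     sorted_wrt (\<lambda>c c'. pos c < pos c') cs \<and> set cs \<subseteq> U \<and> set (zip rs cs) \<subseteq> F"

lemma prod_single_one:
  "(\<Prod>a\<in>A. Poly_Mapping.single (f a) (1::complex)) = Poly_Mapping.single (\<Sum>a\<in>A. f a) 1"
  by (induction A rule: infinite_finite_induct) (auto simp: mult_single)

lemma keys_sum_subset: "(\<And>i. i \<in> A \<Longrightarrow> Poly_Mapping.keys (f i) \<subseteq> M) \<Longrightarrow> Poly_Mapping.keys (sum f A) \<subseteq> M"
proof (induction A rule: infinite_finite_induct)
  case (insert x F)
  then show ?case using keys_add[of "f x" "sum f F"] by auto
qed auto

lemma keys_uminus_eq: "Poly_Mapping.keys (- p :: _ \<Rightarrow>\<^sub>0 complex) = Poly_Mapping.keys p"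
  by (auto simp: in_keys_iff)

text \<open>A monomial whose support is not good is divisible by the diagonal product of a minor in \<open>J\<close>. Modulo
  this minor the diagonal product is a signed sum of the other terms, all of smaller weight.\<close>

lemma monomial_reduction:
  assumes J: "ideal J (CX d k1 k2)"
    and bad: "\<And>F. F \<subseteq> {1..d} \<times> grid k1 k2 \<Longrightarrow> \<not> good F \<Longrightarrow>
      \<exists>rs cs. chain pos (grid k1 k2) F rs cs \<and>
        det (mat (length rs) (length rs) (\<lambda>(a, b). x_var (rs ! a) (cs ! b))) \<in> J"
    and m: "Poly_Mapping.keys m \<subseteq> {1..d} \<times> grid k1 k2"
  shows "\<exists>g. Poly_Mapping.keys g \<subseteq> {n. Poly_Mapping.keys n \<subseteq> {1..d} \<times> grid k1 k2 \<and> good (Poly_Mapping.keys n)}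
    \<and> Poly_Mapping.single m 1 - g \<in> J"
  using m
proof (induction "weight pos m" arbitrary: m rule: less_induct)
  case less
  let ?E = "{1..d} \<times> grid k1 k2"
  let ?M = "{n. Poly_Mapping.keys n \<subseteq> ?E \<and> good (Poly_Mapping.keys n)}"
  show ?case
  proof (cases "good (Poly_Mapping.keys m)")
    case True
    then show ?thesis
      using less.prems ideal_CX_closed(2)[OF J] by (intro exI[of _ "Poly_Mapping.single m 1"]) auto
  next
    case False
    then obtain rs cs where ch: "chain pos (grid k1 k2) (Poly_Mapping.keys m) rs cs"
      and det: "det (mat (length rs) (length rs) (\<lambda>(a, b). x_var (rs ! a) (cs ! b))) \<in> J"
      using bad[OF less.prems] by blast
    define r where "r = length rs"
    have len: "length rs = r" "length cs = r" and entry: "\<And>a. a < r \<Longrightarrow> (rs ! a, cs ! a) \<in> Poly_Mapping.keys m"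
      and rs: "\<And>a b. a < b \<Longrightarrow> b < r \<Longrightarrow> rs ! a < rs ! b"
      and cs: "\<And>a b. a < b \<Longrightarrow> b < r \<Longrightarrow> pos (cs ! a) < pos (cs ! b)"
    proof -
      show "length rs = r" "length cs = r" using ch by (auto simp: chain_def r_def)
      show "(rs ! a, cs ! a) \<in> Poly_Mapping.keys m" if "a < r" for a
      proof -
        have "(rs ! a, cs ! a) \<in> set (zip rs cs)"
          using that ch by (auto simp: set_zip chain_def r_def)
        then show ?thesis using ch unfolding chain_def by blast
      qed
    qed (use ch in \<open>auto simp: chain_def r_def sorted_wrt_iff_nth_less\<close>)
    have in_E: "(rs ! a, cs ! b) \<in> ?E" if "a < r" "b < r" for a b
      using entry[OF that(1)] entry[OF that(2)] less.prems by blast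
    define \<delta> where "\<delta> \<pi> = (\<Sum>a\<in>{0..<r}. Poly_Mapping.single (rs ! a, cs ! \<pi> a) (1::nat))" for \<pi>
    have "Poly_Mapping.lookup (\<delta> id) v \<le> Poly_Mapping.lookup m v" for v
    proof (cases "\<exists>a<r. v = (rs ! a, cs ! a)")
      case True
      then obtain a where a: "a < r" "v = (rs ! a, cs ! a)" by blast
      have "Poly_Mapping.lookup (\<delta> id) v = (\<Sum>b\<in>{0..<r}. if b = a then 1 else 0)"
        unfolding \<delta>_def lookup_sum using a rs
        by (intro sum.cong) (auto simp: lookup_single when_def, metis less_irrefl linorder_neqE_nat)
      also have "\<dots> = 1" using a by simp
      finally show ?thesis using entry[OF a(1)] a(2) by (simp add: in_keys_iff)
    next
      case False
      then have "Poly_Mapping.lookup (\<delta> id) v = 0"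
        unfolding \<delta>_def lookup_sum by (intro sum.neutral) (auto simp: lookup_single when_def)
      then show ?thesis by simp
    qed
    then have "m = (m - \<delta> id) + \<delta> id"
      by (intro poly_mapping_eqI) (simp add: lookup_add lookup_minus)
    then obtain \<mu> where \<mu>: "m = \<mu> + \<delta> id" by blast
    have keys_\<mu>: "Poly_Mapping.keys \<mu> \<subseteq> ?E"
    proof
      fix v assume "v \<in> Poly_Mapping.keys \<mu>"
      then have "v \<in> Poly_Mapping.keys m" by (simp add: \<mu> in_keys_iff lookup_add)
      then show "v \<in> ?E" using less.prems by blast
    qed
    let ?P = "{\<pi>. \<pi> permutes {0..<r}}"
    have keys_\<delta>: "Poly_Mapping.keys (\<mu> + \<delta> \<pi>) \<subseteq> ?E" if "\<pi> permutes {0..<r}" for \<pi>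
    proof -
      have "Poly_Mapping.keys (\<delta> \<pi>) \<subseteq> ?E"
        unfolding \<delta>_def using in_E permutes_in_image[OF that] by (intro keys_sum_subset) auto
      then show ?thesis using keys_\<mu> keys_add[of \<mu> "\<delta> \<pi>"] by blast
    qed
    have wt: "weight pos (\<delta> \<pi>) = (\<Sum>a\<in>{0..<r}. rs ! a * pos (cs ! \<pi> a))" for \<pi>
      unfolding \<delta>_def by (simp add: weight_sum weight_single[unfolded One_nat_def])
    have "weight pos (\<mu> + \<delta> \<pi>) < weight pos m" if "\<pi> permutes {0..<r}" "\<pi> \<noteq> id" for \<pi>
      using rearrangement_strict[of r "\<lambda>a. rs ! a" "\<lambda>a. pos (cs ! a)" \<pi>] that rs cs
      by (simp add: \<mu> weight_add wt)
    then have "\<exists>g. Poly_Mapping.keys g \<subseteq> ?M \<and> Poly_Mapping.single (\<mu> + \<delta> \<pi>) 1 - g \<in> J"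
      if "\<pi> permutes {0..<r}" "\<pi> \<noteq> id" for \<pi>
      using that keys_\<delta> by (intro less.hyps) auto
    then have "\<exists>g. \<forall>\<pi>\<in>?P - {id}. Poly_Mapping.keys (g \<pi>) \<subseteq> ?M \<and> Poly_Mapping.single (\<mu> + \<delta> \<pi>) 1 - g \<pi> \<in> J"
      by (intro bchoice) blast
    then obtain g where g: "\<And>\<pi>. \<pi> \<in> ?P - {id} \<Longrightarrow> Poly_Mapping.keys (g \<pi>) \<subseteq> ?M"
      "\<And>\<pi>. \<pi> \<in> ?P - {id} \<Longrightarrow> Poly_Mapping.single (\<mu> + \<delta> \<pi>) 1 - g \<pi> \<in> J"
      by blast
    define h where "h = - (\<Sum>\<pi>\<in>?P - {id}. signof \<pi> * g \<pi>)"
    have D: "det (mat r r (\<lambda>(a, b). x_var (rs ! a) (cs ! b))) = (\<Sum>\<pi>\<in>?P. signof \<pi> * Poly_Mapping.single (\<delta> \<pi>) 1)"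
    proof -
      have "(\<Prod>a = 0..<r. mat r r (\<lambda>(a, b). x_var (rs ! a) (cs ! b)) $$ (a, \<pi> a)) = Poly_Mapping.single (\<delta> \<pi>) 1"
        if "\<pi> permutes {0..<r}" for \<pi>
        using permutes_in_image[OF that] unfolding \<delta>_def prod_single_one[symmetric] x_var_def
        by (intro prod.cong) auto
      then show ?thesis
        by (subst det_def'[of _ r]) (auto intro!: sum.cong)
    qed
    have "Poly_Mapping.single \<mu> 1 * det (mat r r (\<lambda>(a, b). x_var (rs ! a) (cs ! b)))
        = (\<Sum>\<pi>\<in>?P. signof \<pi> * Poly_Mapping.single (\<mu> + \<delta> \<pi>) 1)"
      unfolding D sum_distrib_left by (intro sum.cong) (simp_all add: mult.left_commute mult_single)
    also have "\<dots> = Poly_Mapping.single m 1 + (\<Sum>\<pi>\<in>?P - {id}. signof \<pi> * Poly_Mapping.single (\<mu> + \<delta> \<pi>) 1)"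
      by (subst sum.remove[of _ id]) (auto simp: finite_permutations permutes_id \<mu>)
    finally have "Poly_Mapping.single m 1 - h
        = Poly_Mapping.single \<mu> 1 * det (mat r r (\<lambda>(a, b). x_var (rs ! a) (cs ! b)))
          - (\<Sum>\<pi>\<in>?P - {id}. signof \<pi> * (Poly_Mapping.single (\<mu> + \<delta> \<pi>) 1 - g \<pi>))"
      by (simp add: h_def right_diff_distrib sum_subtractf)
    also have "\<dots> \<in> J"
    proof (rule ideal_CX_closed(6)[OF J])
      show "Poly_Mapping.single \<mu> 1 * det (mat r r (\<lambda>(a, b). x_var (rs ! a) (cs ! b))) \<in> J"
        using det keys_\<mu> by (intro ideal_CX_closed(4)[OF J]) (auto simp: r_def CX_def)
      have "signof \<pi> \<in> carrier (CX d k1 k2)" for \<pi>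
        using signof_cases[of \<pi>, where 'a = cpoly] CX_1 CX_uminus_closed[OF CX_1] by auto
      then show "(\<Sum>\<pi>\<in>?P - {id}. signof \<pi> * (Poly_Mapping.single (\<mu> + \<delta> \<pi>) 1 - g \<pi>)) \<in> J"
        by (intro ideal_CX_sum[OF J] ideal_CX_closed(4)[OF J] g(2))
    qed
    finally have "Poly_Mapping.single m 1 - h \<in> J" .
    moreover have "Poly_Mapping.keys h \<subseteq> ?M"
      unfolding h_def keys_uminus_eq
    proof (rule keys_sum_subset)
      fix \<pi> assume "\<pi> \<in> ?P - {id}"
      then have "Poly_Mapping.keys (g \<pi>) \<subseteq> ?M" by (rule g(1))
      then show "Poly_Mapping.keys (signof \<pi> * g \<pi>) \<subseteq> ?M"
        using signof_cases[of \<pi>, where 'a = cpoly] keys_uminus_eq[of "g \<pi>"] by auto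
    qed
    ultimately show ?thesis by blast
  qed
qed

lemma poly_reduction:
  assumes J: "ideal J (CX d k1 k2)"
    and bad: "\<And>F. F \<subseteq> {1..d} \<times> grid k1 k2 \<Longrightarrow> \<not> good F \<Longrightarrow>
      \<exists>rs cs. chain pos (grid k1 k2) F rs cs \<and>
        det (mat (length rs) (length rs) (\<lambda>(a, b). x_var (rs ! a) (cs ! b))) \<in> J"
    and p: "p \<in> carrier (CX d k1 k2)"
  obtains g where "p - g \<in> J"
    "\<And>m. m \<in> Poly_Mapping.keys g \<Longrightarrow> Poly_Mapping.keys m \<subseteq> {1..d} \<times> grid k1 k2 \<and> good (Poly_Mapping.keys m)"
proof -
  let ?M = "{n. Poly_Mapping.keys n \<subseteq> {1..d} \<times> grid k1 k2 \<and> good (Poly_Mapping.keys n)}"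
  have "\<exists>g. Poly_Mapping.keys g \<subseteq> ?M \<and> Poly_Mapping.single m 1 - g \<in> J" if m: "m \<in> Poly_Mapping.keys p" for m
  proof (rule monomial_reduction[OF J bad])
    show "Poly_Mapping.keys m \<subseteq> {1..d} \<times> grid k1 k2"
      using m p by (simp add: CX_def)
  qed
  then have "\<exists>g. \<forall>m\<in>Poly_Mapping.keys p. Poly_Mapping.keys (g m) \<subseteq> ?M \<and> Poly_Mapping.single m 1 - g m \<in> J"
    by (intro bchoice) blast
  then obtain g where g: "\<And>m. m \<in> Poly_Mapping.keys p \<Longrightarrow> Poly_Mapping.keys (g m) \<subseteq> ?M"
    "\<And>m. m \<in> Poly_Mapping.keys p \<Longrightarrow> Poly_Mapping.single m 1 - g m \<in> J"
    by blast
  let ?c = "\<lambda>m. Poly_Mapping.single 0 (Poly_Mapping.lookup p m)"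
  define h where "h = (\<Sum>m\<in>Poly_Mapping.keys p. ?c m * g m)"
  have "p - h = (\<Sum>m\<in>Poly_Mapping.keys p. ?c m * (Poly_Mapping.single m 1 - g m))"
    unfolding h_def by (subst (1) poly_sum_singles[of p, symmetric])
      (simp add: right_diff_distrib mult_single sum_subtractf)
  also have "\<dots> \<in> J"
    by (intro ideal_CX_sum[OF J] ideal_CX_closed(4)[OF J] g(2)) (auto simp: CX_def)
  finally have "p - h \<in> J" .
  moreover have "Poly_Mapping.keys h \<subseteq> ?M"
    unfolding h_def
  proof (rule keys_sum_subset)
    fix m assume "m \<in> Poly_Mapping.keys p"
    then have "Poly_Mapping.keys (g m) \<subseteq> ?M" by (rule g(1))
    then show "Poly_Mapping.keys (?c m * g m) \<subseteq> ?M"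
      using keys_mult[of "?c m" "g m"] by (auto split: if_splits)
  qed
  ultimately show ?thesis using that[of h] by blast
qed

section \<open>Curves in the zero set\<close>

lemma exp_decay:
  fixes k :: real
  assumes "k \<le> 0"
  shows "((\<lambda>\<tau>. exp (k * \<tau>)) \<longlongrightarrow> (if k = 0 then 1 else 0)) at_top"
proof (cases "k = 0")
  case False
  then have "filterlim (\<lambda>\<tau>. k * \<tau>) at_bot at_top"
    using assms by (intro filterlim_tendsto_neg_mult_at_bot[OF tendsto_const _ filterlim_ident]) auto
  then show ?thesis
    using False filterlim_compose[OF exp_at_bot] by simp
qed simp

abbreviation diagonal :: "(nat \<Rightarrow> nat) \<Rightarrow> (nat \<times> nat) set \<Rightarrow> bool" where
  "diagonal q A \<equiv> \<forall>e\<in>A. \<forall>f\<in>A. e = f \<or>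
     fst e < fst f \<and> q (snd e) < q (snd f) \<or> fst f < fst e \<and> q (snd f) < q (snd e)"

text \<open>The columns are divided into the classes 0, 1, 2 in this order. What is needed is a colouring of the
  elements of \<open>D\<close> by \<open>s\<close> colours in which each colour is a staircase and one colour avoids class 1,
  where the classes 0 and 2 may share a colour freely. This is Dilworth's theorem for the following
  order: \<open>e\<close> is below \<open>f\<close> if \<open>f\<close> lies weakly to the lower left of \<open>e\<close>, or if \<open>e\<close> is of class 2 and \<open>f\<close>
  of class 0; and an extra element \<open>None\<close> lies between the classes 2 and 0 and is incomparable to
  class 1. Antichains are then exactly the strictly increasing sets within the classes 0, 1 or the
  classes 1, 2, with \<open>None\<close> admitted only beside class 1. The colour of \<open>None\<close> is the one that avoids class 1.\<close>

lemma staircase_partition: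
  fixes q cls :: "nat \<Rightarrow> nat" and D :: "(nat \<times> nat) set"
  assumes fin: "finite D" and q: "inj_on q (snd ` D)"
    and cls: "\<And>e f. e \<in> D \<Longrightarrow> f \<in> D \<Longrightarrow> q (snd e) \<le> q (snd f) \<Longrightarrow> cls (snd e) \<le> cls (snd f)"
      "\<And>e. e \<in> D \<Longrightarrow> cls (snd e) \<le> 2"
    and mid: "\<And>A. A \<subseteq> D \<Longrightarrow> diagonal q A \<Longrightarrow>
        (\<forall>e\<in>A. cls (snd e) = 1) \<Longrightarrow> card A < s"
    and left: "\<And>A. A \<subseteq> D \<Longrightarrow> diagonal q A \<Longrightarrow>
        (\<forall>e\<in>A. cls (snd e) \<le> 1) \<Longrightarrow> card A \<le> s"
    and right: "\<And>A. A \<subseteq> D \<Longrightarrow> diagonal q A \<Longrightarrow>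
        (\<forall>e\<in>A. 1 \<le> cls (snd e)) \<Longrightarrow> card A \<le> s"
  obtains \<G> where "finite \<G>" "\<Union>\<G> = D" "disjoint \<G>"
    "\<And>G e f. G \<in> \<G> \<Longrightarrow> e \<in> G \<Longrightarrow> f \<in> G \<Longrightarrow> fst e < fst f \<Longrightarrow> q (snd f) \<le> q (snd e)"
    "card {G \<in> \<G>. \<exists>e\<in>G. cls (snd e) = 1} < s"
    "card {G \<in> \<G>. \<exists>e\<in>G. cls (snd e) \<le> 1} \<le> s"
    "card {G \<in> \<G>. \<exists>e\<in>G. 1 \<le> cls (snd e)} \<le> s"
proof -
  define le :: "(nat \<times> nat) option \<Rightarrow> (nat \<times> nat) option \<Rightarrow> bool" where
    "le x y = (case (x, y) of (None, None) \<Rightarrow> True | (None, Some f) \<Rightarrow> cls (snd f) = 0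
        | (Some e, None) \<Rightarrow> cls (snd e) = 2
        | (Some e, Some f) \<Rightarrow> fst e \<le> fst f \<and> q (snd f) \<le> q (snd e) \<or> cls (snd e) = 2 \<and> cls (snd f) = 0)" for x y
  have le_simps: "le None None" "le None (Some f) \<longleftrightarrow> cls (snd f) = 0" "le (Some e) None \<longleftrightarrow> cls (snd e) = 2"
    "le (Some e) (Some f) \<longleftrightarrow> fst e \<le> fst f \<and> q (snd f) \<le> q (snd e) \<or> cls (snd e) = 2 \<and> cls (snd f) = 0" for e f
    by (auto simp: le_def)
  define P where "P = insert None (Some ` D)"
  have "\<exists>c. (\<forall>x\<in>P. c x < s) \<and> (\<forall>x\<in>P. \<forall>y\<in>P. c x = c y \<longrightarrow> le x y \<or> le y x)"
  proof (rule dilworth)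
    show "finite P" using fin by (simp add: P_def)
    show "le x x" for x by (cases x) (auto simp: le_simps)
  next
    fix x y z assume xyz: "x \<in> P" "y \<in> P" "z \<in> P" "le x y" "le y z"
    have low: "cls l' = 0" if "q l' \<le> q l" "cls l = 0" "(i, l) \<in> D" "(i', l') \<in> D" for i l i' l'
      using cls(1)[of "(i', l')" "(i, l)"] that by simp
    have high: "cls l' = 2" if "q l \<le> q l'" "cls l = 2" "(i, l) \<in> D" "(i', l') \<in> D" for i l i' l'
      using cls(1)[of "(i, l)" "(i', l')"] cls(2)[of "(i', l')"] that by simp
    show "le x z"
      using xyz unfolding P_def
      by (cases x; cases y; cases z) (auto simp: le_simps dest: low high)
  next
    fix x y assume xy: "x \<in> P" "y \<in> P" "le x y" "le y x"
    show "x = y"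
    proof (cases "x = None \<or> y = None")
      case True
      then show ?thesis using xy(3,4) by (cases x; cases y) (simp_all add: le_simps)
    next
      case False
      then obtain e f where ef: "x = Some e" "y = Some f" by auto
      then have D: "e \<in> D" "f \<in> D" using xy by (auto simp: P_def)
      have "q (snd f) \<le> q (snd e) \<Longrightarrow> \<not> (cls (snd f) = 2 \<and> cls (snd e) = 0)"
           "q (snd e) \<le> q (snd f) \<Longrightarrow> \<not> (cls (snd e) = 2 \<and> cls (snd f) = 0)"
        using cls(1)[of f e] cls(1)[of e f] D by auto
      then have "fst e = fst f" "q (snd e) = q (snd f)"
        using xy by (auto simp: ef le_simps)
      moreover have "snd e = snd f"
        using \<open>q (snd e) = q (snd f)\<close> D inj_onD[OF q, of "snd e" "snd f"] by simp
      ultimately show ?thesis using ef by (simp add: prod_eq_iff)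
    qed
  next
    fix A assume A: "A \<subseteq> P" "\<forall>x\<in>A. \<forall>y\<in>A. le x y \<longrightarrow> x = y"
    define B where "B = {e. Some e \<in> A}"
    have B: "B \<subseteq> D" using A(1) by (auto simp: B_def P_def)
    have strict: "diagonal q B"
    proof (intro ballI)
      fix e f assume "e \<in> B" "f \<in> B"
      then have "le (Some e) (Some f) \<Longrightarrow> e = f" "le (Some f) (Some e) \<Longrightarrow> e = f"
        using A(2) unfolding B_def by blast+
      then show "e = f \<or> fst e < fst f \<and> q (snd e) < q (snd f) \<or> fst f < fst e \<and> q (snd f) < q (snd e)"
        unfolding le_simps by linarith
    qed
    have finB: "finite B" using B fin finite_subset by blast
    show "card A \<le> s"
    proof (cases "None \<in> A")
      case True
      have "cls (snd e) = 1" if "e \<in> B" for e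
      proof -
        have "\<not> le None (Some e)" "\<not> le (Some e) None"
          using A(2) True that unfolding B_def by blast+
        then show ?thesis using cls(2)[of e] that B by (auto simp: le_simps)
      qed
      then have "card B < s" using mid B strict by simp
      moreover have "A = insert None (Some ` B)"
      proof (rule Set.set_eqI)
        show "x \<in> A \<longleftrightarrow> x \<in> insert None (Some ` B)" for x
          using True by (cases x) (auto simp: B_def)
      qed
      ultimately show ?thesis
        using finB by (simp add: card_image)
    next
      case False
      have "A = Some ` B"
      proof (rule Set.set_eqI)
        show "x \<in> A \<longleftrightarrow> x \<in> Some ` B" for x
          using False by (cases x) (auto simp: B_def)
      qed
      then have card: "card A = card B" by (simp add: card_image)
      have "\<not> (e \<in> B \<and> f \<in> B \<and> cls (snd e) = 2 \<and> cls (snd f) = 0)" for e f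
        using A(2) unfolding B_def by (force simp: le_simps)
      then have "(\<forall>e\<in>B. cls (snd e) \<le> 1) \<or> (\<forall>e\<in>B. 1 \<le> cls (snd e))"
        using cls(2) B by (metis Suc_leI le_SucE less_one linorder_not_less numeral_2_eq_2 One_nat_def subsetD)
      then show ?thesis
        using left[OF B strict] right[OF B strict] card by auto
    qed
  qed
  then obtain c where c: "\<And>x. x \<in> P \<Longrightarrow> c x < s"
    "\<And>x y. x \<in> P \<Longrightarrow> y \<in> P \<Longrightarrow> c x = c y \<Longrightarrow> le x y \<or> le y x"
    by blast
  have in_P: "Some e \<in> P" "None \<in> P" if "e \<in> D" for e using that by (auto simp: P_def)
  \<comment> \<open>A colour that class 1 does not use may join elements of the classes 0 and 2 that form a diagonal;
    such colours are split in two.\<close>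
  define central where "central \<gamma> \<longleftrightarrow> (\<exists>e\<in>D. c (Some e) = \<gamma> \<and> cls (snd e) = 1)" for \<gamma>
  define \<kappa> where "\<kappa> e = (c (Some e), if central (c (Some e)) then 0 else cls (snd e))" for e
  define fib where "fib k = {f \<in> D. \<kappa> f = k}" for k
  define \<G> where "\<G> = (\<lambda>e. fib (\<kappa> e)) ` D"
  show ?thesis
  proof
    show "finite \<G>" using fin by (simp add: \<G>_def)
    show "\<Union>\<G> = D" by (auto simp: \<G>_def fib_def)
    show "disjoint \<G>" by (auto simp: \<G>_def fib_def disjoint_def)
  next
    fix G e f assume "G \<in> \<G>" "e \<in> G" "f \<in> G" and row: "fst e < fst f"
    then have ef: "e \<in> D" "f \<in> D" "\<kappa> e = \<kappa> f" by (auto simp: \<G>_def fib_def)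
    show "q (snd f) \<le> q (snd e)"
    proof (rule ccontr)
      assume "\<not> ?thesis"
      then have qq: "q (snd e) < q (snd f)" by simp
      then have cc: "cls (snd e) \<le> cls (snd f)" using cls(1)[of e f] ef by simp
      have "le (Some e) (Some f) \<or> le (Some f) (Some e)"
        using c(2)[of "Some e" "Some f"] ef in_P by (auto simp: \<kappa>_def)
      then have far: "cls (snd f) = 2" "cls (snd e) = 0"
        using qq row cc unfolding le_simps by auto
      then have "central (c (Some e))"
        using ef(3) by (auto simp: \<kappa>_def split: if_splits)
      then obtain y where y: "y \<in> D" "c (Some y) = c (Some e)" "cls (snd y) = 1"
        by (auto simp: central_def)
      \<comment> \<open>an element of class 1 with the same colour would have to lie weakly above \<open>e\<close> and weakly below \<open>f\<close>\<close>
      have "le (Some y) (Some e) \<or> le (Some e) (Some y)"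
        using c(2)[of "Some y" "Some e"] ef in_P y by auto
      then have 1: "fst y \<le> fst e"
        using cls(1)[of y e] y ef far unfolding le_simps by auto
      have "le (Some y) (Some f) \<or> le (Some f) (Some y)"
        using c(2)[of "Some y" "Some f"] ef in_P y by (auto simp: \<kappa>_def)
      then have "fst f \<le> fst y"
        using cls(1)[of f y] y ef far unfolding le_simps by auto
      then show False using 1 row by simp
    qed
  next
    have "{G \<in> \<G>. \<exists>e\<in>G. cls (snd e) = 1} \<subseteq> (\<lambda>\<gamma>. fib (\<gamma>, 0)) ` ({..<s} - {c None})"
    proof
      fix G assume "G \<in> {G \<in> \<G>. \<exists>e\<in>G. cls (snd e) = 1}"
      then obtain e where e: "e \<in> D" "cls (snd e) = 1" "G = fib (\<kappa> e)"
        by (auto simp: \<G>_def fib_def)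
      have "\<kappa> e = (c (Some e), 0)" using e by (auto simp: \<kappa>_def central_def)
      moreover have "c (Some e) \<noteq> c None"
        using c(2)[of "Some e" None] in_P[OF e(1)] e by (auto simp: le_simps)
      moreover have "c (Some e) < s" using c(1) in_P[OF e(1)] by blast
      ultimately show "G \<in> (\<lambda>\<gamma>. fib (\<gamma>, 0)) ` ({..<s} - {c None})"
        using e(3) by auto
    qed
    then have "card {G \<in> \<G>. \<exists>e\<in>G. cls (snd e) = 1} \<le> card ({..<s} - {c None})"
      by (intro surj_card_le) auto
    also have "\<dots> < s" using c(1)[of None] by (simp add: P_def)
    finally show "card {G \<in> \<G>. \<exists>e\<in>G. cls (snd e) = 1} < s" .
  next
    have "{G \<in> \<G>. \<exists>e\<in>G. cls (snd e) \<le> 1} \<subseteq> (\<lambda>\<gamma>. fib (\<gamma>, 0)) ` {..<s}"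
    proof
      fix G assume "G \<in> {G \<in> \<G>. \<exists>e\<in>G. cls (snd e) \<le> 1}"
      then obtain e where e: "e \<in> D" "cls (snd e) \<le> 1" "G = fib (\<kappa> e)"
        by (auto simp: \<G>_def fib_def)
      have "\<kappa> e = (c (Some e), 0)" using e by (auto simp: \<kappa>_def central_def le_Suc_eq)
      moreover have "c (Some e) < s" using c(1) in_P[OF e(1)] by blast
      ultimately show "G \<in> (\<lambda>\<gamma>. fib (\<gamma>, 0)) ` {..<s}"
        using e(3) by auto
    qed
    then have "card {G \<in> \<G>. \<exists>e\<in>G. cls (snd e) \<le> 1} \<le> card {..<s}"
      by (intro surj_card_le) auto
    then show "card {G \<in> \<G>. \<exists>e\<in>G. cls (snd e) \<le> 1} \<le> s" by simp
  next
    have "{G \<in> \<G>. \<exists>e\<in>G. 1 \<le> cls (snd e)} \<subseteq> (\<lambda>\<gamma>. fib (\<gamma>, if central \<gamma> then 0 else 2)) ` {..<s}"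
    proof
      fix G assume "G \<in> {G \<in> \<G>. \<exists>e\<in>G. 1 \<le> cls (snd e)}"
      then obtain e where e: "e \<in> D" "1 \<le> cls (snd e)" "G = fib (\<kappa> e)"
        by (auto simp: \<G>_def fib_def)
      have "\<not> central (c (Some e)) \<Longrightarrow> cls (snd e) = 2"
        using e cls(2)[OF e(1)] by (force simp: central_def)
      then have "\<kappa> e = (c (Some e), if central (c (Some e)) then 0 else 2)"
        by (auto simp: \<kappa>_def)
      moreover have "c (Some e) < s" using c(1) in_P[OF e(1)] by blast
      ultimately show "G \<in> (\<lambda>\<gamma>. fib (\<gamma>, if central \<gamma> then 0 else 2)) ` {..<s}"
        using e(3) by auto
    qed
    then have "card {G \<in> \<G>. \<exists>e\<in>G. 1 \<le> cls (snd e)} \<le> card {..<s}"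
      by (intro surj_card_le) auto
    then show "card {G \<in> \<G>. \<exists>e\<in>G. 1 \<le> cls (snd e)} \<le> s" by simp
  qed
qed

text \<open>The columns of \<open>T\<close> come in blocks, one for each \<open>l\<close>, and \<open>q\<close> arranges the blocks in a row; \<open>pos\<close>
  refines this to an arrangement of all columns. The class \<open>cls l\<close> of a block is 0, 1 or 2, increasing
  along \<open>q\<close>, so that the blocks of the classes 0, 1 and those of the classes 1, 2 are intervals which
  overlap in class 1.\<close>

locale block_arrangement =
  fixes d k1 k2 :: nat and T :: "column set" and pos :: "column \<Rightarrow> nat" and q cls :: "nat \<Rightarrow> nat"
  assumes T_grid: "T \<subseteq> grid k1 k2"
    and T_block: "\<And>l. l \<in> {1..k2} \<Longrightarrow> \<exists>c\<in>T. snd c = l"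
    and pos_inj: "inj_on pos (grid k1 k2)"
    and q_inj: "inj_on q {1..k2}"
    and pos_q: "\<And>c c'. c \<in> grid k1 k2 \<Longrightarrow> c' \<in> grid k1 k2 \<Longrightarrow> q (snd c) < q (snd c') \<Longrightarrow> pos c < pos c'"
    and cls_mono: "\<And>l l'. l \<in> {1..k2} \<Longrightarrow> l' \<in> {1..k2} \<Longrightarrow> q l \<le> q l' \<Longrightarrow> cls l \<le> cls l'"
    and cls_le: "\<And>l. l \<in> {1..k2} \<Longrightarrow> cls l \<le> 2"
begin

definition block :: "nat \<Rightarrow> column set" where "block l = {c \<in> T. snd c = l}"

definition zone :: "nat set \<Rightarrow> column set" where "zone B = {c \<in> T. cls (snd c) \<in> B}"

definition chain_free :: "nat \<Rightarrow> column set \<Rightarrow> indet set \<Rightarrow> bool" where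
  "chain_free r U F \<longleftrightarrow> (\<nexists>rs cs. chain pos U F rs cs \<and> length rs = r)"

lemma snd_T: "c \<in> T \<Longrightarrow> snd c \<in> {1..k2}"
  using T_grid by (auto simp: grid_def)

text \<open>Choosing one column from each block turns a diagonal of (row, block) pairs into a diagonal of
  matrix entries, since \<open>pos\<close> respects the order of the blocks.\<close>

lemma lift_chain:
  assumes free: "chain_free r (zone B) F"
    and A: "A \<subseteq> {(i, l). \<exists>c\<in>block l. (i, c) \<in> F}" "finite A"
    and strict: "diagonal q A"
    and B: "\<forall>e\<in>A. cls (snd e) \<in> B"
  shows "card A < r"
proof (rule ccontr)
  assume "\<not> card A < r"
  then obtain A' where A': "A' \<subseteq> A" "card A' = r"
    using obtain_subset_with_card_n[of r A] by auto
  have finA': "finite A'" using A' A finite_subset by blast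
  have "\<forall>i\<in>fst ` A'. \<exists>c. (i, snd c) \<in> A' \<and> c \<in> block (snd c) \<and> (i, c) \<in> F"
  proof
    fix i assume "i \<in> fst ` A'"
    then obtain l where l: "(i, l) \<in> A'" by auto
    then obtain c where "c \<in> block l" "(i, c) \<in> F" using A A' by blast
    then show "\<exists>c. (i, snd c) \<in> A' \<and> c \<in> block (snd c) \<and> (i, c) \<in> F"
      using l by (intro exI[of _ c]) (auto simp: block_def)
  qed
  then obtain col where col: "\<And>i. i \<in> fst ` A' \<Longrightarrow> (i, snd (col i)) \<in> A'"
    "\<And>i. i \<in> fst ` A' \<Longrightarrow> col i \<in> block (snd (col i))" "\<And>i. i \<in> fst ` A' \<Longrightarrow> (i, col i) \<in> F"
    by metis
  define rs where "rs = sorted_list_of_set (fst ` A')"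
  have set_rs: "set rs = fst ` A'" and srt: "sorted_wrt (<) rs"
    using finA' by (simp_all add: rs_def)
  have "inj_on fst A'"
    using strict A'(1) unfolding inj_on_def by (metis nat_neq_iff subsetD)
  then have len: "length rs = r"
    using A'(2) by (simp add: rs_def card_image)
  have "chain pos (zone B) F rs (map col rs)"
    unfolding chain_def
  proof (intro conjI)
    show "sorted_wrt (\<lambda>c c'. pos c < pos c') (map col rs)"
      unfolding sorted_wrt_map
    proof (rule sorted_wrt_mono_rel[OF _ srt])
      fix i j assume ij: "i \<in> set rs" "j \<in> set rs" "i < j"
      then have "(i, snd (col i)) \<in> A" "(j, snd (col j)) \<in> A" using col(1) set_rs A'(1) by auto
      then have "q (snd (col i)) < q (snd (col j))" using strict ij(3) by fastforce
      moreover have "col i \<in> grid k1 k2" "col j \<in> grid k1 k2"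
        using col(2) ij set_rs T_grid unfolding block_def by blast+
      ultimately show "pos (col i) < pos (col j)" by (intro pos_q)
    qed
    show "set (map col rs) \<subseteq> zone B"
    proof
      fix c assume "c \<in> set (map col rs)"
      then obtain i where i: "i \<in> fst ` A'" "c = col i" using set_rs by auto
      then have "(i, snd c) \<in> A" "c \<in> block (snd c)" using col(1,2) A'(1) by blast+
      then show "c \<in> zone B" using B by (auto simp: zone_def block_def)
    qed
    show "set (zip rs (map col rs)) \<subseteq> F"
    proof
      fix e assume "e \<in> set (zip rs (map col rs))"
      then obtain i where "i \<in> set rs" "e = (i, col i)" by (auto simp: zip_map2 zip_same_conv_map)
      then show "e \<in> F" using col(3) set_rs by simp
    qed
  qed (auto simp: srt)
  then show False using free len by (auto simp: chain_free_def)
qed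

text \<open>The curve of points of the zero set that degenerates to the coordinate subspace of \<open>F\<close>. In each
  block, \<open>F\<close> is a staircase, and its potentials \<open>\<alpha> l i + \<zeta> c\<close> reduce the problem to the matrix with rows
  \<open>i\<close>, one column per block \<open>l\<close>, and weights \<open>\<alpha> l i\<close>. These weights are again supermodular, and the
  image \<open>D\<close> of \<open>F\<close> in this matrix contains a diagonal only if \<open>F\<close> does. Splitting \<open>D\<close> into staircases
  and adding one rank-one matrix for each of them bounds the rank on every zone by the number of
  staircases that meet it.\<close>

lemma arc_exists:
  fixes \<eta> :: "indet \<Rightarrow> real"
  assumes d: "1 \<le> d" and F: "F \<subseteq> {1..d} \<times> grid k1 k2"
    and block_free: "\<And>l. l \<in> {1..k2} \<Longrightarrow> chain_free 2 (block l) F"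
    and mid_free: "chain_free s (zone {1}) F"
    and left_free: "chain_free (Suc s) (zone {0, 1}) F"
    and right_free: "chain_free (Suc s) (zone {1, 2}) F"
    and \<eta>: "\<And>e. 0 \<le> \<eta> e \<and> \<eta> e \<le> 1 / 16"
  obtains x :: "real \<Rightarrow> indet \<Rightarrow> complex" where
    "\<And>e. e \<in> {1..d} \<times> grid k1 k2 \<Longrightarrow>
      ((\<lambda>\<tau>. x \<tau> e * of_real (exp (- (real (fst e * pos (snd e)) + \<eta> e) * \<tau>))) \<longlongrightarrow> (if e \<in> F then 1 else 0)) at_top"
    "\<And>\<tau> l rs cs. set cs \<subseteq> block l \<Longrightarrow> length cs = 2 \<Longrightarrow> det (mat 2 2 (\<lambda>(a, b). x \<tau> (rs ! a, cs ! b))) = 0"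
    "\<And>\<tau> rs cs. set cs \<subseteq> zone {1} \<Longrightarrow> length cs = s \<Longrightarrow> det (mat s s (\<lambda>(a, b). x \<tau> (rs ! a, cs ! b))) = 0"
    "\<And>\<tau> rs cs. set cs \<subseteq> zone {0, 1} \<Longrightarrow> length cs = Suc s \<Longrightarrow>
      det (mat (Suc s) (Suc s) (\<lambda>(a, b). x \<tau> (rs ! a, cs ! b))) = 0"
    "\<And>\<tau> rs cs. set cs \<subseteq> zone {1, 2} \<Longrightarrow> length cs = Suc s \<Longrightarrow>
      det (mat (Suc s) (Suc s) (\<lambda>(a, b). x \<tau> (rs ! a, cs ! b))) = 0"
    "\<And>\<tau> i c. c \<notin> T \<Longrightarrow> (i, c) \<notin> F \<Longrightarrow> x \<tau> (i, c) = 0"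
proof -
  have finF: "finite F" using F by (rule finite_subset) (simp add: grid_def)
  have fin_block: "finite (block l)" for l
  proof (rule finite_subset)
    show "block l \<subseteq> grid k1 k2" using T_grid by (auto simp: block_def)
    show "finite (grid k1 k2)" by (simp add: grid_def)
  qed
  \<comment> \<open>Lowering the weights off \<open>F\<close> by \<open>1 / 16\<close> keeps the potentials strictly below \<open>w\<close> there. The second
    differences of \<open>i * pos c\<close> for distinct columns are at least 1. The perturbations of their four
    entries change them by at most \<open>1 / 4\<close>, which leaves room for another lowering by \<open>1 / 16\<close> in \<open>v\<close>.\<close>
  define pert where "pert e = \<eta> e - (if e \<in> F then 0 else 1 / 16)" for e
  have pert: "- (1 / 16) \<le> pert e \<and> pert e \<le> 1 / 16" for e
    using \<eta>[of e] by (auto simp: pert_def)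
  define w' where "w' i c = real (i * pos c) + pert (i, c)" for i c
  have w'_diff: "real (pos c) - 1 / 8 \<le> w' (Suc i) c - w' i c" "w' (Suc i) c - w' i c \<le> real (pos c) + 1 / 8" for i c
    using pert[of "(Suc i, c)"] pert[of "(i, c)"] by (auto simp: w'_def algebra_simps)
  define inner where "inner l a b \<longleftrightarrow> (\<forall>i c. 1 \<le> i \<and> i \<le> d \<and> c \<in> block l \<longrightarrow> a i + b c \<le> w' i c) \<and>
      (\<forall>i c. (i, c) \<in> F \<and> c \<in> block l \<longrightarrow> a i + b c = w' i c) \<and>
      (\<forall>i. 1 \<le> i \<and> i < d \<longrightarrow> (\<exists>c\<in>block l. a (Suc i) - a i = w' (Suc i) c - w' i c))"
    for l a b
  have "\<exists>a b. inner l a b"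
    if l: "l \<in> {1..k2}" for l
  proof -
    obtain a b where
      "\<And>i c. 1 \<le> i \<Longrightarrow> i \<le> d \<Longrightarrow> c \<in> block l \<Longrightarrow> a i + b c \<le> w' i c"
      "\<And>i c. (i, c) \<in> F \<inter> UNIV \<times> block l \<Longrightarrow> a i + b c = w' i c"
      "\<And>i. 1 \<le> i \<Longrightarrow> i < d \<Longrightarrow> \<exists>c\<in>block l. a (Suc i) - a i = w' (Suc i) c - w' i c"
    proof (rule staircase_potential[of "block l" d "F \<inter> UNIV \<times> block l" pos w'])
      show "finite (block l)" by (rule fin_block)
      show "block l \<noteq> {}" using T_block[OF l] by (auto simp: block_def)
      show "1 \<le> d" by (rule d)
      show "F \<inter> UNIV \<times> block l \<subseteq> {1..d} \<times> block l" using F by blast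
    next
      fix i c i' c' assume *: "(i, c) \<in> F \<inter> UNIV \<times> block l" "(i', c') \<in> F \<inter> UNIV \<times> block l" "i < i'"
      show "pos c' \<le> pos c"
      proof (rule ccontr)
        assume "\<not> pos c' \<le> pos c"
        then have "chain pos (block l) F [i, i'] [c, c']"
          using * by (auto simp: chain_def)
        then show False using block_free[OF l] by (auto simp: chain_free_def)
      qed
    next
      fix i c c' assume c: "c \<in> block l" "c' \<in> block l" "pos c \<le> pos c'"
      show "w' (Suc i) c - w' i c \<le> w' (Suc i) c' - w' i c'"
      proof (cases "pos c = pos c'")
        case True
        then have "c = c'" using c pos_inj T_grid by (auto simp: block_def dest!: inj_onD)
        then show ?thesis by simp
      next
        case False
        then have "real (pos c) + 1 \<le> real (pos c')" using c(3) by linarith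
        then show ?thesis using w'_diff(2)[of i c] w'_diff(1)[of c' i] by linarith
      qed
    qed blast
    then have "inner l a b" unfolding inner_def by blast
    then show ?thesis by blast
  qed
  then obtain \<alpha> \<zeta>' where inner: "\<And>l. l \<in> {1..k2} \<Longrightarrow> inner l (\<alpha> l) (\<zeta>' l)"
    by metis
  then have \<alpha>:
    "\<And>l i c. l \<in> {1..k2} \<Longrightarrow> 1 \<le> i \<Longrightarrow> i \<le> d \<Longrightarrow> c \<in> block l \<Longrightarrow> \<alpha> l i + \<zeta>' l c \<le> w' i c"
    "\<And>l i c. l \<in> {1..k2} \<Longrightarrow> (i, c) \<in> F \<Longrightarrow> c \<in> block l \<Longrightarrow> \<alpha> l i + \<zeta>' l c = w' i c"
    "\<And>l i. l \<in> {1..k2} \<Longrightarrow> 1 \<le> i \<Longrightarrow> i < d \<Longrightarrow> \<exists>c\<in>block l. \<alpha> l (Suc i) - \<alpha> l i = w' (Suc i) c - w' i c"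
    unfolding inner_def by blast+
  define \<zeta> where "\<zeta> c = \<zeta>' (snd c) c" for c
  define D where "D = {(i, l). \<exists>c\<in>block l. (i, c) \<in> F}"
  have D_sub: "D \<subseteq> {1..d} \<times> {1..k2}"
    using F snd_T by (fastforce simp: D_def block_def)
  have finD: "finite D" using D_sub by (rule finite_subset) simp
  have snd_D: "snd e \<in> {1..k2}" if "e \<in> D" for e using that D_sub by auto
  note lift = lift_chain[where F = F, folded D_def]
  obtain \<G> where \<G>: "finite \<G>" "\<Union>\<G> = D" "disjoint \<G>"
    "\<And>G e f. G \<in> \<G> \<Longrightarrow> e \<in> G \<Longrightarrow> f \<in> G \<Longrightarrow> fst e < fst f \<Longrightarrow> q (snd f) \<le> q (snd e)"
    "card {G \<in> \<G>. \<exists>e\<in>G. cls (snd e) = 1} < s"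
    "card {G \<in> \<G>. \<exists>e\<in>G. cls (snd e) \<le> 1} \<le> s"
    "card {G \<in> \<G>. \<exists>e\<in>G. 1 \<le> cls (snd e)} \<le> s"
  proof (rule staircase_partition[of D q cls s])
    show "finite D" by (rule finD)
    show "inj_on q (snd ` D)"
      using q_inj snd_D by (auto intro: inj_on_subset)
    show "cls (snd e) \<le> cls (snd f)" if "e \<in> D" "f \<in> D" "q (snd e) \<le> q (snd f)" for e f
      using cls_mono snd_D that by blast
    show "cls (snd e) \<le> 2" if "e \<in> D" for e
      using cls_le snd_D that by blast
  next
    fix A assume A: "A \<subseteq> D" "diagonal q A"
    then have finA: "finite A" using finD finite_subset by blast
    show "card A < s" if "\<forall>e\<in>A. cls (snd e) = 1"
      using that by (intro lift[OF mid_free A(1) finA A(2)]) auto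
    have "card A < Suc s" if "\<forall>e\<in>A. cls (snd e) \<le> 1"
      using that by (intro lift[OF left_free A(1) finA A(2)]) (auto simp: le_Suc_eq)
    then show "card A \<le> s" if "\<forall>e\<in>A. cls (snd e) \<le> 1" using that by simp
    have "card A < Suc s" if "\<forall>e\<in>A. 1 \<le> cls (snd e)"
      using that cls_le[OF snd_D] A(1)
      by (intro lift[OF right_free A(1) finA A(2)]) (force simp: le_Suc_eq numeral_2_eq_2)
    then show "card A \<le> s" if "\<forall>e\<in>A. 1 \<le> cls (snd e)" using that by simp
  qed blast
  have finG: "finite G" "G \<subseteq> D" if "G \<in> \<G>" for G
    using that \<G>(2) finD by (auto intro: finite_subset)
  define v where "v G i l = \<alpha> l i - (if (i, l) \<in> G then 0 else 1 / 16)" for G :: "(nat \<times> nat) set" and i l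
  define outer where "outer G a b \<longleftrightarrow> (\<forall>i l. 1 \<le> i \<and> i \<le> d \<and> l \<in> snd ` G \<longrightarrow> a i + b l \<le> v G i l) \<and>
      (\<forall>i l. (i, l) \<in> G \<longrightarrow> a i + b l = v G i l)" for G a b
  have "\<exists>a b. outer G a b" if G: "G \<in> \<G>" for G
  proof (cases "G = {}")
    case False
    obtain a b where
      "\<And>i l. 1 \<le> i \<Longrightarrow> i \<le> d \<Longrightarrow> l \<in> snd ` G \<Longrightarrow> a i + b l \<le> v G i l"
      "\<And>i l. (i, l) \<in> G \<Longrightarrow> a i + b l = v G i l"
    proof (rule staircase_potential[of "snd ` G" d G q "v G"])
      show "finite (snd ` G)" "snd ` G \<noteq> {}" using finG[OF G] False by auto
      show "1 \<le> d" by (rule d)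
      show "G \<subseteq> {1..d} \<times> snd ` G" using finG[OF G] D_sub by force
      show "q l' \<le> q l" if "(i, l) \<in> G" "(i', l') \<in> G" "i < i'" for i l i' l'
        using \<G>(4)[OF G that(1,2)] that(3) by simp
    next
      fix i l l' assume *: "1 \<le> i" "i < d" "l \<in> snd ` G" "l' \<in> snd ` G" "q l \<le> q l'"
      then have ll: "l \<in> {1..k2}" "l' \<in> {1..k2}" using finG[OF G] snd_D by auto
      show "v G (Suc i) l - v G i l \<le> v G (Suc i) l' - v G i l'"
      proof (cases "l = l'")
        case False
        then have "q l < q l'" using * ll inj_onD[OF q_inj] by (metis le_neq_implies_less)
        obtain c where c: "c \<in> block l" "\<alpha> l (Suc i) - \<alpha> l i = w' (Suc i) c - w' i c"
          using \<alpha>(3)[OF ll(1) *(1,2)] by blast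
        obtain c' where c': "c' \<in> block l'" "\<alpha> l' (Suc i) - \<alpha> l' i = w' (Suc i) c' - w' i c'"
          using \<alpha>(3)[OF ll(2) *(1,2)] by blast
        have "pos c < pos c'"
          using c c' T_grid \<open>q l < q l'\<close> by (intro pos_q) (auto simp: block_def)
        then have "real (pos c) + 1 \<le> real (pos c')" by linarith
        then have "\<alpha> l (Suc i) - \<alpha> l i + 3 / 4 \<le> \<alpha> l' (Suc i) - \<alpha> l' i"
          using w'_diff(2)[of i c] w'_diff(1)[of c' i] c(2) c'(2) by linarith
        then show ?thesis unfolding v_def by (simp split: if_splits)
      qed simp
    qed blast
    then have "outer G a b" unfolding outer_def by blast
    then show ?thesis by blast
  qed (auto simp: outer_def)
  then obtain A B where outer: "\<And>G. G \<in> \<G> \<Longrightarrow> outer G (A G) (B G)"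
    by metis
  then have AB:
    "\<And>G i l. G \<in> \<G> \<Longrightarrow> 1 \<le> i \<Longrightarrow> i \<le> d \<Longrightarrow> l \<in> snd ` G \<Longrightarrow> A G i + B G l \<le> v G i l"
    "\<And>G i l. G \<in> \<G> \<Longrightarrow> (i, l) \<in> G \<Longrightarrow> A G i + B G l = v G i l"
    unfolding outer_def by blast+
  define x :: "real \<Rightarrow> indet \<Rightarrow> complex" where
    "x \<tau> e = (case e of (i, c) \<Rightarrow>
      if c \<in> T then (\<Sum>G\<in>\<G>. of_real (exp (A G i * \<tau>)) *
        (if snd c \<in> snd ` G then of_real (exp (B G (snd c) * \<tau>)) else 0)) * of_real (exp (\<zeta> c * \<tau>))
      else if (i, c) \<in> F then of_real (exp ((real (i * pos c) + \<eta> (i, c)) * \<tau>)) else 0)" for \<tau> e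
  have low_rank: "det (mat r r (\<lambda>(a, b). x \<tau> (rs ! a, cs ! b))) = 0"
    if cs: "set cs \<subseteq> T" "length cs = r" and few: "card {G \<in> \<G>. snd ` G \<inter> snd ` set cs \<noteq> {}} < r" for r \<tau> rs cs
  proof -
    let ?K = "{G \<in> \<G>. snd ` G \<inter> snd ` set cs \<noteq> {}}"
    have "mat r r (\<lambda>(a, b). x \<tau> (rs ! a, cs ! b)) = mat r r (\<lambda>(a, b). \<Sum>G\<in>?K. of_real (exp (A G (rs ! a) * \<tau>)) *
       ((if snd (cs ! b) \<in> snd ` G then of_real (exp (B G (snd (cs ! b)) * \<tau>)) else 0) * of_real (exp (\<zeta> (cs ! b) * \<tau>))))"
    proof (rule cong_mat)
      fix a b assume b: "b < r"
      have mem: "cs ! b \<in> set cs" using cs b by simp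
      then have "x \<tau> (rs ! a, cs ! b) = (\<Sum>G\<in>\<G>. of_real (exp (A G (rs ! a) * \<tau>)) *
       ((if snd (cs ! b) \<in> snd ` G then of_real (exp (B G (snd (cs ! b)) * \<tau>)) else 0) * of_real (exp (\<zeta> (cs ! b) * \<tau>))))"
        using cs(1) by (auto simp: x_def sum_distrib_right mult.assoc)
      also have "\<dots> = (\<Sum>G\<in>?K. of_real (exp (A G (rs ! a) * \<tau>)) *
       ((if snd (cs ! b) \<in> snd ` G then of_real (exp (B G (snd (cs ! b)) * \<tau>)) else 0) * of_real (exp (\<zeta> (cs ! b) * \<tau>))))"
        using \<G>(1) mem by (intro sum.mono_neutral_right) auto
      finally show "(case (a, b) of (a, b) \<Rightarrow> x \<tau> (rs ! a, cs ! b)) = (case (a, b) of (a, b) \<Rightarrow> \<Sum>G\<in>?K. of_real (exp (A G (rs ! a) * \<tau>)) *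
       ((if snd (cs ! b) \<in> snd ` G then of_real (exp (B G (snd (cs ! b)) * \<tau>)) else 0) * of_real (exp (\<zeta> (cs ! b) * \<tau>))))"
        by simp
    qed auto
    also have "det \<dots> = 0"
      using \<G>(1) few by (intro det_low_rank) auto
    finally show ?thesis .
  qed
  have zone_rank: "det (mat r r (\<lambda>(a, b). x \<tau> (rs ! a, cs ! b))) = 0"
    if cs: "set cs \<subseteq> zone S" "length cs = r" and few: "card {G \<in> \<G>. \<exists>e\<in>G. cls (snd e) \<in> S} < r" for r S \<tau> rs cs
  proof (rule low_rank)
    show "set cs \<subseteq> T" "length cs = r" using cs by (auto simp: zone_def)
    have "{G \<in> \<G>. snd ` G \<inter> snd ` set cs \<noteq> {}} \<subseteq> {G \<in> \<G>. \<exists>e\<in>G. cls (snd e) \<in> S}"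
    proof
      fix G assume "G \<in> {G \<in> \<G>. snd ` G \<inter> snd ` set cs \<noteq> {}}"
      then obtain e c where "G \<in> \<G>" "e \<in> G" "c \<in> set cs" "snd e = snd c" by auto
      moreover from this have "cls (snd c) \<in> S" using cs(1) by (auto simp: zone_def)
      ultimately show "G \<in> {G \<in> \<G>. \<exists>e\<in>G. cls (snd e) \<in> S}" by (intro CollectI conjI bexI[of _ e]) simp_all
    qed
    then show "card {G \<in> \<G>. snd ` G \<inter> snd ` set cs \<noteq> {}} < r"
      using \<G>(1) few by (intro le_less_trans[OF card_mono few]) auto
  qed
  show ?thesis
  proof (rule that[of x])
    fix e assume "e \<in> {1..d} \<times> grid k1 k2"
    then obtain i c where e: "e = (i, c)" "1 \<le> i" "i \<le> d" "c \<in> grid k1 k2" by auto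
    define w where "w = real (i * pos c) + \<eta> e"
    have "((\<lambda>\<tau>. x \<tau> e * of_real (exp (- w * \<tau>))) \<longlongrightarrow> (if e \<in> F then 1 else 0)) at_top"
    proof (cases "c \<in> T")
      case False
      then have "(\<lambda>\<tau>. x \<tau> e * of_real (exp (- w * \<tau>))) = (\<lambda>\<tau>. if e \<in> F then 1 else 0)"
        by (auto simp: x_def e w_def fun_eq_iff simp flip: of_real_mult exp_add distrib_right)
      then show ?thesis by simp
    next
      case True
      define l where "l = snd c"
      have l: "l \<in> {1..k2}" "c \<in> block l" using True snd_T by (auto simp: l_def block_def)
      \<comment> \<open>the rates of growth of the summands of \<open>x \<tau> e\<close>, relative to \<open>exp (w * \<tau>)\<close>\<close>
      define K where "K G = A G i + B G l + \<zeta> c - w" for G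
      have w: "w = w' i c + (if e \<in> F then 0 else 1 / 16)" by (simp add: w_def w'_def pert_def e)
      have K_le: "K G \<le> 0" "K G = 0 \<longleftrightarrow> e \<in> F \<and> (i, l) \<in> G" if G: "G \<in> \<G>" "l \<in> snd ` G" for G
      proof -
        have 1: "A G i + B G l \<le> v G i l" "(i, l) \<in> G \<Longrightarrow> A G i + B G l = v G i l"
          using AB(1)[OF G(1) e(2,3) G(2)] AB(2)[OF G(1)] by auto
        have 2: "\<alpha> l i + \<zeta> c \<le> w' i c" "e \<in> F \<Longrightarrow> \<alpha> l i + \<zeta> c = w' i c"
          using \<alpha>(1)[OF l(1) e(2,3) l(2)] \<alpha>(2)[OF l(1) _ l(2)] by (auto simp: \<zeta>_def l_def e)
        show "K G \<le> 0" "K G = 0 \<longleftrightarrow> e \<in> F \<and> (i, l) \<in> G"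
          using 1 2 unfolding K_def w v_def by (auto split: if_splits)
      qed
      have "x \<tau> e * of_real (exp (- w * \<tau>)) = (\<Sum>G\<in>\<G>. of_real (if l \<in> snd ` G then exp (K G * \<tau>) else 0))" for \<tau>
      proof -
        have split: "exp (K G * \<tau>) = exp (A G i * \<tau>) * exp (B G l * \<tau>) * exp (\<zeta> c * \<tau>) * exp (- w * \<tau>)" for G
          by (simp add: K_def algebra_simps flip: exp_add)
        have "x \<tau> e * of_real (exp (- w * \<tau>)) = (\<Sum>G\<in>\<G>. of_real (exp (A G i * \<tau>)) *
            (if l \<in> snd ` G then of_real (exp (B G l * \<tau>)) else 0) * of_real (exp (\<zeta> c * \<tau>)) * of_real (exp (- w * \<tau>)))"
          unfolding l_def using True by (simp add: x_def e sum_distrib_right)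
        also have "\<dots> = (\<Sum>G\<in>\<G>. of_real (if l \<in> snd ` G then exp (K G * \<tau>) else 0))"
          unfolding split by (intro sum.cong) simp_all
        finally show ?thesis .
      qed
      moreover have "((\<lambda>\<tau>. \<Sum>G\<in>\<G>. complex_of_real (if l \<in> snd ` G then exp (K G * \<tau>) else 0)) \<longlongrightarrow>
         (\<Sum>G\<in>\<G>. complex_of_real (if l \<in> snd ` G then (if K G = 0 then 1 else 0) else 0))) at_top"
      proof (intro tendsto_sum tendsto_of_real)
        fix G assume "G \<in> \<G>"
        then show "((\<lambda>\<tau>. if l \<in> snd ` G then exp (K G * \<tau>) else 0) \<longlongrightarrow> (if l \<in> snd ` G then (if K G = 0 then 1 else 0) else 0)) at_top"
          using exp_decay[of "K G"] K_le(1)[of G] by (cases "l \<in> snd ` G") auto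
      qed
      moreover have "(\<Sum>G\<in>\<G>. complex_of_real (if l \<in> snd ` G then (if K G = 0 then 1 else 0) else 0)) = (if e \<in> F then 1 else 0)"
      proof (cases "e \<in> F")
        case True
        then have "(i, l) \<in> D" using l e by (auto simp: D_def)
        then obtain G0 where G0: "G0 \<in> \<G>" "(i, l) \<in> G0" using \<G>(2) by blast
        have uniq: "G = G0" if "G \<in> \<G>" "(i, l) \<in> G" for G
          using disjointD[OF \<G>(3) that(1) G0(1)] that(2) G0(2) by blast
        have "(\<Sum>G\<in>\<G>. complex_of_real (if l \<in> snd ` G then (if K G = 0 then 1 else 0) else 0)) = (\<Sum>G\<in>\<G>. if G = G0 then 1 else 0)"
        proof (intro sum.cong refl)
          fix G assume G: "G \<in> \<G>"
          have "l \<in> snd ` G0" using G0(2) by force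
          then show "complex_of_real (if l \<in> snd ` G then (if K G = 0 then 1 else 0) else 0) = (if G = G0 then 1 else 0)"
          proof (cases "G = G0")
            case eq: True
            then have "K G = 0" using K_le(2)[OF G] \<open>l \<in> snd ` G0\<close> True G0(2) by blast
            then show ?thesis using eq \<open>l \<in> snd ` G0\<close> by simp
          next
            case neq: False
            then have "\<not> (l \<in> snd ` G \<and> K G = 0)" using K_le(2)[OF G] uniq[OF G] by blast
            then show ?thesis using neq by auto
          qed
        qed
        then show ?thesis using True G0 \<G>(1) by simp
      next
        case False
        have "complex_of_real (if l \<in> snd ` G then (if K G = 0 then 1 else 0) else 0) = 0" if "G \<in> \<G>" for G
          using K_le(2)[OF that] False by (cases "l \<in> snd ` G") simp_all
        then show ?thesis using False by (subst sum.neutral) simp_all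
      qed
      ultimately show ?thesis by simp
    qed
    then show "((\<lambda>\<tau>. x \<tau> e * of_real (exp (- (real (fst e * pos (snd e)) + \<eta> e) * \<tau>))) \<longlongrightarrow> (if e \<in> F then 1 else 0)) at_top"
      by (simp add: w_def e)
  next
    fix \<tau> l rs cs assume cs: "set cs \<subseteq> block l" "length cs = (2 :: nat)"
    have entry: "x \<tau> (rs ! a, cs ! b) = (\<Sum>u\<in>{()}. (\<Sum>G\<in>\<G>. of_real (exp (A G (rs ! a) * \<tau>)) *
        (if l \<in> snd ` G then of_real (exp (B G l * \<tau>)) else 0)) * of_real (exp (\<zeta> (cs ! b) * \<tau>)))" if "b < 2" for a b
    proof -
      have "cs ! b \<in> block l" using cs nth_mem[of b cs] that by auto
      then show ?thesis by (simp add: x_def block_def cong: if_cong)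
    qed
    have "mat 2 2 (\<lambda>(a, b). x \<tau> (rs ! a, cs ! b)) = mat 2 2 (\<lambda>(a, b). \<Sum>u\<in>{()}. (\<Sum>G\<in>\<G>. of_real (exp (A G (rs ! a) * \<tau>)) *
        (if l \<in> snd ` G then of_real (exp (B G l * \<tau>)) else 0)) * of_real (exp (\<zeta> (cs ! b) * \<tau>)))"
      by (rule cong_mat) (simp_all only: entry prod.case)
    also have "det \<dots> = 0"
      by (rule det_low_rank) simp_all
    finally show "det (mat 2 2 (\<lambda>(a, b). x \<tau> (rs ! a, cs ! b))) = 0" .
  next
    fix \<tau> rs cs assume "set cs \<subseteq> zone {1}" "length cs = s"
    then show "det (mat s s (\<lambda>(a, b). x \<tau> (rs ! a, cs ! b))) = 0"
      using \<G>(5) by (intro zone_rank) auto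
  next
    fix \<tau> rs cs assume cs: "set cs \<subseteq> zone {0, 1}" "length cs = Suc s"
    have "cls (snd e) \<in> {0, 1} \<Longrightarrow> cls (snd e) \<le> 1" for e :: "nat \<times> nat" by auto
    then have "{G \<in> \<G>. \<exists>e\<in>G. cls (snd e) \<in> {0, 1}} \<subseteq> {G \<in> \<G>. \<exists>e\<in>G. cls (snd e) \<le> 1}" by blast
    then have "card {G \<in> \<G>. \<exists>e\<in>G. cls (snd e) \<in> {0, 1}} \<le> card {G \<in> \<G>. \<exists>e\<in>G. cls (snd e) \<le> 1}"
      using \<G>(1) by (intro card_mono) auto
    then show "det (mat (Suc s) (Suc s) (\<lambda>(a, b). x \<tau> (rs ! a, cs ! b))) = 0"
      using \<G>(6) cs by (intro zone_rank) auto
  next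
    fix \<tau> rs cs assume cs: "set cs \<subseteq> zone {1, 2}" "length cs = Suc s"
    have "cls (snd e) \<in> {1, 2} \<Longrightarrow> 1 \<le> cls (snd e)" for e :: "nat \<times> nat" by auto
    then have "{G \<in> \<G>. \<exists>e\<in>G. cls (snd e) \<in> {1, 2}} \<subseteq> {G \<in> \<G>. \<exists>e\<in>G. 1 \<le> cls (snd e)}" by blast
    then have "card {G \<in> \<G>. \<exists>e\<in>G. cls (snd e) \<in> {1, 2}} \<le> card {G \<in> \<G>. \<exists>e\<in>G. 1 \<le> cls (snd e)}"
      using \<G>(1) by (intro card_mono) auto
    then show "det (mat (Suc s) (Suc s) (\<lambda>(a, b). x \<tau> (rs ! a, cs ! b))) = 0"
      using \<G>(7) cs by (intro zone_rank) auto
  next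
    fix \<tau> i c assume "c \<notin> T" "(i, c) \<notin> F"
    then show "x \<tau> (i, c) = 0" by (simp add: x_def)
  qed
qed

end

section \<open>Independence of the good monomials on the zero set\<close>

text \<open>With the perturbation \<open>\<theta>\<close>, \<open>\<theta>\<^sup>2\<close>, ... of the weights of the variables, the difference of the
  weights of two monomials is a polynomial in \<open>\<theta>\<close> whose coefficients are the differences of the
  exponents. So all but finitely many \<open>\<theta>\<close> separate the given monomials.\<close>

lemma generic_perturbation:
  fixes M :: "('v::countable \<Rightarrow>\<^sub>0 nat) set" and base :: "'v \<Rightarrow> real"
  assumes "finite M" "0 < \<epsilon>" "\<epsilon> \<le> 1"
  obtains \<eta> :: "'v \<Rightarrow> real" where "\<And>e. 0 \<le> \<eta> e \<and> \<eta> e \<le> \<epsilon>"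
    "inj_on (\<lambda>m. \<Sum>e\<in>Poly_Mapping.keys m. real (Poly_Mapping.lookup m e) * (base e + \<eta> e)) M"
proof -
  define E where "E = (\<Union>m\<in>M. Poly_Mapping.keys m)"
  have E: "finite E" "\<And>m. m \<in> M \<Longrightarrow> Poly_Mapping.keys m \<subseteq> E"
    using assms(1) by (auto simp: E_def)
  define c where "c m n e = real (Poly_Mapping.lookup m e) - real (Poly_Mapping.lookup n e)"
    for m n :: "'v \<Rightarrow>\<^sub>0 nat" and e
  define P where "P m n = (\<Sum>e\<in>E. [:c m n e * base e:] + monom (c m n e) (Suc (to_nat e)))" for m n
  have "P m n \<noteq> 0" if mn: "m \<in> M" "n \<in> M" "m \<noteq> n" for m n
  proof -
    obtain e0 where e0: "Poly_Mapping.lookup m e0 \<noteq> Poly_Mapping.lookup n e0"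
      using mn(3) by (auto simp: poly_mapping_eq_iff fun_eq_iff)
    have e0E: "e0 \<in> E"
    proof (cases "Poly_Mapping.lookup m e0 = 0")
      case True
      then show ?thesis using e0 E(2)[OF mn(2)] by (auto simp: in_keys_iff)
    next
      case False
      then show ?thesis using E(2)[OF mn(1)] by (auto simp: in_keys_iff)
    qed
    have "coeff (P m n) (Suc (to_nat e0)) = (\<Sum>e\<in>E. if e = e0 then c m n e else 0)"
      unfolding P_def coeff_sum by (intro sum.cong) (auto simp: coeff_pCons)
    also have "\<dots> = c m n e0" using E(1) e0E by simp
    also have "\<dots> \<noteq> 0" using e0 by (simp add: c_def)
    finally show ?thesis by auto
  qed
  then have roots: "finite {\<theta>. poly (P m n) \<theta> = 0}" if "m \<in> M" "n \<in> M" "m \<noteq> n" for m n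
    using that by (intro poly_roots_finite) blast
  define bad where "bad = (\<Union>m\<in>M. \<Union>n\<in>M - {m}. {\<theta>. poly (P m n) \<theta> = 0})"
  have "finite bad"
    unfolding bad_def using assms(1) roots by (intro finite_UN_I) auto
  moreover have "infinite {0<..<\<epsilon>}" using assms(2) by (simp add: infinite_Ioo)
  ultimately have "{0<..<\<epsilon>} - bad \<noteq> {}" by (metis Diff_eq_empty_iff finite_subset)
  then obtain \<theta> where "\<theta> \<in> {0<..<\<epsilon>} - bad" by blast
  then have \<theta>: "0 < \<theta>" "\<theta> < \<epsilon>" "\<theta> \<notin> bad" by auto
  have nonroot: "poly (P m n) \<theta> \<noteq> 0" if "m \<in> M" "n \<in> M" "m \<noteq> n" for m n
    using \<theta>(3) that by (auto simp: bad_def)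
  define \<eta> where "\<eta> e = \<theta> ^ Suc (to_nat e)" for e :: 'v
  show ?thesis
  proof
    fix e :: 'v
    have "\<theta> ^ to_nat e \<le> 1" using \<theta> assms by (intro power_le_one) auto
    then have "\<eta> e \<le> \<theta>" using \<theta>(1) by (simp add: \<eta>_def)
    moreover have "0 \<le> \<eta> e" using \<theta>(1) by (simp add: \<eta>_def)
    ultimately show "0 \<le> \<eta> e \<and> \<eta> e \<le> \<epsilon>" using \<theta>(2) by linarith
  next
    show "inj_on (\<lambda>m. \<Sum>e\<in>Poly_Mapping.keys m. real (Poly_Mapping.lookup m e) * (base e + \<eta> e)) M"
    proof (rule inj_onI, rule ccontr)
      fix m n assume mn: "m \<in> M" "n \<in> M" "m \<noteq> n"
        and eq: "(\<Sum>e\<in>Poly_Mapping.keys m. real (Poly_Mapping.lookup m e) * (base e + \<eta> e)) =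
          (\<Sum>e\<in>Poly_Mapping.keys n. real (Poly_Mapping.lookup n e) * (base e + \<eta> e))"
      have sup: "(\<Sum>e\<in>Poly_Mapping.keys h. real (Poly_Mapping.lookup h e) * (base e + \<eta> e)) =
          (\<Sum>e\<in>E. real (Poly_Mapping.lookup h e) * (base e + \<eta> e))" if "h \<in> M" for h
        using E that by (intro sum.mono_neutral_left) (auto simp: in_keys_iff)
      have "poly (P m n) \<theta> = (\<Sum>e\<in>E. c m n e * (base e + \<eta> e))"
        by (simp add: P_def poly_sum poly_monom \<eta>_def distrib_left)
      also have "\<dots> = 0"
        using eq unfolding sup[OF mn(1)] sup[OF mn(2)] by (simp add: c_def left_diff_distrib sum_subtractf)
      finally show False using nonroot[OF mn] by simp
    qed
  qed
qed

text \<open>Listing the columns of a minor in another order than the lexicographic one costs at most a sign.\<close>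

lemma minor_mem:
  assumes J: "ideal J (CX d k1 k2)" "minors d r U \<subseteq> J"
    and rs: "length rs = r" "sorted_wrt (<) rs" "set rs \<subseteq> {1..d}"
    and cs: "length cs = r" "distinct cs" "set cs \<subseteq> U"
  shows "det (mat r r (\<lambda>(a, b). x_var (rs ! a) (cs ! b))) \<in> J"
proof -
  define cs' where "cs' = sorted_list_of_set (set cs)"
  have cs': "length cs' = r" "set cs' = set cs" "sorted_wrt (<) cs'"
    using cs by (simp_all add: cs'_def distinct_card)
  have lex: "sorted_wrt (\<lambda>c c'. (c, c') \<in> less_than <*lex*> less_than) cs'"
    by (rule sorted_wrt_mono_rel[OF _ cs'(3)]) (auto simp: less_prod_def')
  have "mset cs = mset cs'"
    using cs(2) cs'(2) by (subst set_eq_iff_mset_eq_distinct[symmetric]) (simp_all add: cs'_def)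
  then obtain p where p: "p permutes {..<length cs'}" "permute_list p cs' = cs"
    by (rule mset_eq_permutation)
  have p': "p permutes {0..<r}" using p(1) cs'(1) by (simp add: lessThan_atLeast0)
  let ?M = "mat r r (\<lambda>(a, b). x_var (rs ! a) (cs' ! b))"
  have "det ?M \<in> minors d r U"
    unfolding minors_def using rs cs cs' lex by blast
  then have M: "det ?M \<in> J" using J(2) by blast
  have "mat r r (\<lambda>(a, b). x_var (rs ! a) (cs ! b)) = transpose_mat (mat r r (\<lambda>(a, b). transpose_mat ?M $$ (p a, b)))"
  proof (rule eq_matI)
    fix a b assume "a < dim_row (transpose_mat (mat r r (\<lambda>(a, b). transpose_mat ?M $$ (p a, b))))"
      "b < dim_col (transpose_mat (mat r r (\<lambda>(a, b). transpose_mat ?M $$ (p a, b))))"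
    then have ab: "a < r" "b < r" by auto
    then have "p b < r" using permutes_in_image[OF p', of b] by simp
    moreover have "cs ! b = cs' ! p b"
      using p ab cs'(1) by (metis permute_list_nth)
    ultimately show "mat r r (\<lambda>(a, b). x_var (rs ! a) (cs ! b)) $$ (a, b) =
        transpose_mat (mat r r (\<lambda>(a, b). transpose_mat ?M $$ (p a, b))) $$ (a, b)"
      using ab by simp
  qed auto
  then have "det (mat r r (\<lambda>(a, b). x_var (rs ! a) (cs ! b))) = signof p * det (transpose_mat ?M)"
    by (simp add: det_transpose[of _ r] det_permute_rows[OF _ p'])
  also have "\<dots> = signof p * det ?M" by (simp add: det_transpose[of _ r])
  also have "\<dots> \<in> J"
    using signof_cases[of p, where 'a = cpoly] M ideal_CX_closed(5)[OF J(1) M] by auto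
  finally show ?thesis .
qed

lemma ideal_eval_kernel: "ideal {f \<in> carrier (CX d k1 k2). eval_poly x f = 0} (CX d k1 k2)"
proof -
  let ?R = "CX d k1 k2"
  interpret cring ?R by (rule cring_CX)
  have ops: "x \<otimes>\<^bsub>?R\<^esub> y = x * y" "x \<oplus>\<^bsub>?R\<^esub> y = x + y" "\<zero>\<^bsub>?R\<^esub> = 0" for x y
    by (simp_all add: CX_def)
  have neg: "inv\<^bsub>add_monoid ?R\<^esub> f = - f" if "f \<in> carrier ?R" for f
  proof -
    have "\<ominus>\<^bsub>?R\<^esub> f = - f"
      using that by (intro minus_equality) (auto simp: ops CX_uminus_closed)
    then show ?thesis by (simp add: a_inv_def)
  qed
  have eval_neg: "eval_poly x (- f) = - eval_poly x f" for f
    using eval_poly_add[of x f "- f"] by (simp add: eq_neg_iff_add_eq_0 add.commute)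
  show ?thesis
  proof (rule idealI)
    show "ring ?R" ..
    show "subgroup {f \<in> carrier ?R. eval_poly x f = 0} (add_monoid ?R)"
    proof (rule subgroup.intro)
      fix f assume "f \<in> {f \<in> carrier ?R. eval_poly x f = 0}"
      then show "inv\<^bsub>add_monoid ?R\<^esub> f \<in> {f \<in> carrier ?R. eval_poly x f = 0}"
        by (simp only: mem_Collect_eq neg) (simp add: CX_uminus_closed eval_neg)
    qed (auto simp: ops eval_poly_add CX_add_closed CX_0)
  qed (auto simp: ops eval_poly_mult CX_mult_closed)
qed

lemma CX_pow: "f [^]\<^bsub>CX d k1 k2\<^esub> (n::nat) = f ^ n"
  by (induction n) (auto simp: nat_pow_def CX_def mult.commute)

context block_arrangement
begin

text \<open>The supports of the monomials that are divisible by no diagonal product of a generator. The variables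
  in the columns \<open>Z\<close> are generators themselves.\<close>

definition good :: "nat \<Rightarrow> column set \<Rightarrow> indet set \<Rightarrow> bool" where
  "good s Z F \<longleftrightarrow> (\<forall>l\<in>{1..k2}. chain_free 2 (block l) F) \<and> chain_free s (zone {1}) F \<and>
     chain_free (Suc s) (zone {0, 1}) F \<and> chain_free (Suc s) (zone {1, 2}) F \<and> (\<forall>(i, c)\<in>F. c \<notin> Z)"

definition vanishing :: "nat \<Rightarrow> column set \<Rightarrow> (indet \<Rightarrow> complex) \<Rightarrow> bool" where
  "vanishing s Z x \<longleftrightarrow> (\<forall>p \<in> (\<Union>l\<in>{1..k2}. minors d 2 (block l)) \<union> minors d s (zone {1}) \<union>
     minors d (Suc s) (zone {0, 1}) \<union> minors d (Suc s) (zone {1, 2}) \<union> minors d 1 Z. eval_poly x p = 0)"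

lemma vanishingD:
  assumes "vanishing s Z x"
  shows "l \<in> {1..k2} \<Longrightarrow> p \<in> minors d 2 (block l) \<Longrightarrow> eval_poly x p = 0"
    "p \<in> minors d s (zone {1}) \<Longrightarrow> eval_poly x p = 0"
    "p \<in> minors d (Suc s) (zone {0, 1}) \<Longrightarrow> eval_poly x p = 0"
    "p \<in> minors d (Suc s) (zone {1, 2}) \<Longrightarrow> eval_poly x p = 0"
    "p \<in> minors d 1 Z \<Longrightarrow> eval_poly x p = 0"
  using assms unfolding vanishing_def by blast+

text \<open>For generic weights, \<open>g\<close> has a unique heaviest monomial \<open>m0\<close>. Along the curve belonging to the
  support of \<open>m0\<close>, this monomial grows like \<open>exp (W m0 * \<tau>)\<close> and every other one more slowly, so \<open>g\<close> cannot
  vanish on the whole curve.\<close>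

lemma good_polys_independent:
  assumes d: "1 \<le> d" and Z: "Z \<inter> T = {}" and g: "g \<noteq> 0"
    and good: "\<And>m. m \<in> Poly_Mapping.keys g \<Longrightarrow>
      Poly_Mapping.keys m \<subseteq> {1..d} \<times> grid k1 k2 \<and> good s Z (Poly_Mapping.keys m)"
  obtains x where "vanishing s Z x" "eval_poly x g \<noteq> 0"
proof -
  define base where "base e = real (fst e * pos (snd e))" for e :: indet
  obtain \<eta> :: "indet \<Rightarrow> real" where \<eta>: "\<And>e. 0 \<le> \<eta> e \<and> \<eta> e \<le> 1 / 16"
    "inj_on (\<lambda>m. \<Sum>e\<in>Poly_Mapping.keys m. real (Poly_Mapping.lookup m e) * (base e + \<eta> e)) (Poly_Mapping.keys g)"
    using generic_perturbation[of "Poly_Mapping.keys g" "1 / 16" base] by auto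
  define w where "w e = base e + \<eta> e" for e
  define W where "W m = (\<Sum>e\<in>Poly_Mapping.keys m. real (Poly_Mapping.lookup m e) * w e)" for m
  have W_inj: "inj_on W (Poly_Mapping.keys g)" using \<eta>(2) unfolding W_def w_def .
  have ne: "Poly_Mapping.keys g \<noteq> {}" using g by simp
  then obtain m0 where m0: "m0 \<in> Poly_Mapping.keys g" "W m0 = Max (W ` Poly_Mapping.keys g)"
  proof -
    have "Max (W ` Poly_Mapping.keys g) \<in> W ` Poly_Mapping.keys g" using ne by (intro Max_in) simp_all
    then show thesis using that by auto
  qed
  have max: "W m - W m0 \<le> 0" "W m - W m0 = 0 \<longleftrightarrow> m = m0" if "m \<in> Poly_Mapping.keys g" for m
  proof -
    have "W m \<le> W m0" unfolding m0(2) using that by (intro Max_ge) simp_all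
    then show "W m - W m0 \<le> 0" by simp
    show "W m - W m0 = 0 \<longleftrightarrow> m = m0" using inj_onD[OF W_inj _ that m0(1)] by auto
  qed
  define F where "F = Poly_Mapping.keys m0"
  have F: "F \<subseteq> {1..d} \<times> grid k1 k2" "good s Z F" using good[OF m0(1)] by (auto simp: F_def)
  obtain x :: "real \<Rightarrow> indet \<Rightarrow> complex" where
    lim: "\<And>e. e \<in> {1..d} \<times> grid k1 k2 \<Longrightarrow>
      ((\<lambda>\<tau>. x \<tau> e * of_real (exp (- w e * \<tau>))) \<longlongrightarrow> (if e \<in> F then 1 else 0)) at_top" and
    det2: "\<And>\<tau> l rs cs. set cs \<subseteq> block l \<Longrightarrow> length cs = 2 \<Longrightarrow> det (mat 2 2 (\<lambda>(a, b). x \<tau> (rs ! a, cs ! b))) = 0" and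
    det_mid: "\<And>\<tau> rs cs. set cs \<subseteq> zone {1} \<Longrightarrow> length cs = s \<Longrightarrow> det (mat s s (\<lambda>(a, b). x \<tau> (rs ! a, cs ! b))) = 0" and
    det_left: "\<And>\<tau> rs cs. set cs \<subseteq> zone {0, 1} \<Longrightarrow> length cs = Suc s \<Longrightarrow>
      det (mat (Suc s) (Suc s) (\<lambda>(a, b). x \<tau> (rs ! a, cs ! b))) = 0" and
    det_right: "\<And>\<tau> rs cs. set cs \<subseteq> zone {1, 2} \<Longrightarrow> length cs = Suc s \<Longrightarrow>
      det (mat (Suc s) (Suc s) (\<lambda>(a, b). x \<tau> (rs ! a, cs ! b))) = 0" and
    zero: "\<And>\<tau> i c. c \<notin> T \<Longrightarrow> (i, c) \<notin> F \<Longrightarrow> x \<tau> (i, c) = 0"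
    using arc_exists[OF d F(1), of s \<eta>] F(2) \<eta>(1) unfolding good_def w_def base_def by blast
  have van: "vanishing s Z (x \<tau>)" for \<tau>
    unfolding vanishing_def
  proof
    have minor: "eval_poly (x \<tau>) p = 0" if pU: "p \<in> minors d r U"
      and dets: "\<And>rs cs. set cs \<subseteq> U \<Longrightarrow> length cs = r \<Longrightarrow> det (mat r r (\<lambda>(a, b). x \<tau> (rs ! a, cs ! b))) = 0" for p r U
    proof -
      obtain rs cs where p: "p = det (mat r r (\<lambda>(a, b). x_var (rs ! a) (cs ! b)))" "length cs = r" "set cs \<subseteq> U"
        using pU unfolding minors_def by blast
      show ?thesis unfolding p(1) eval_poly_minor using p(3,2) by (rule dets)
    qed
    fix p assume "p \<in> (\<Union>l\<in>{1..k2}. minors d 2 (block l)) \<union> minors d s (zone {1}) \<union>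
     minors d (Suc s) (zone {0, 1}) \<union> minors d (Suc s) (zone {1, 2}) \<union> minors d 1 Z"
    then consider l where "p \<in> minors d 2 (block l)" | "p \<in> minors d s (zone {1})"
      | "p \<in> minors d (Suc s) (zone {0, 1})" | "p \<in> minors d (Suc s) (zone {1, 2})" | "p \<in> minors d 1 Z"
      by blast
    then show "eval_poly (x \<tau>) p = 0"
    proof cases
      case 1
      then show ?thesis using det2 by (rule minor)
    next
      case 2
      then show ?thesis using det_mid by (rule minor)
    next
      case 3
      then show ?thesis using det_left by (rule minor)
    next
      case 4
      then show ?thesis using det_right by (rule minor)
    next
      case 5
      then obtain rs cs where p: "p = det (mat 1 1 (\<lambda>(a, b). x_var (rs ! a) (cs ! b)))" "length cs = 1" "set cs \<subseteq> Z"
        unfolding minors_def by blast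
      then have "cs ! 0 \<in> Z" using nth_mem[of 0 cs] by auto
      then have "x \<tau> (rs ! 0, cs ! 0) = 0" using F(2) Z by (intro zero) (auto simp: good_def)
      then have "mat 1 1 (\<lambda>(a, b). x \<tau> (rs ! a, cs ! b)) = mat 1 1 (\<lambda>(a, b). 0)"
        by (intro cong_mat) auto
      moreover have "det (mat 1 1 (\<lambda>(a, b). 0 :: complex)) = 0"
        using det_low_rank[of "{} :: nat set" 1 "\<lambda>_ _. 0" "\<lambda>_ _. 0 :: complex"] by simp
      ultimately show ?thesis unfolding p eval_poly_minor by simp
    qed
  qed
  have "((\<lambda>\<tau>. eval_poly (x \<tau>) g * of_real (exp (- W m0 * \<tau>))) \<longlongrightarrow> Poly_Mapping.lookup g m0) at_top"
  proof -
    define L where "L m = (\<Prod>e\<in>Poly_Mapping.keys m. (if e \<in> F then 1 else 0 :: complex) ^ Poly_Mapping.lookup m e)" for m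
    have monom: "((\<lambda>\<tau>. eval_monom (x \<tau>) m * of_real (exp (- W m * \<tau>))) \<longlongrightarrow> L m) at_top"
      if "m \<in> Poly_Mapping.keys g" for m
    proof -
      have "eval_monom (x \<tau>) m * of_real (exp (- W m * \<tau>)) =
          (\<Prod>e\<in>Poly_Mapping.keys m. (x \<tau> e * of_real (exp (- w e * \<tau>))) ^ Poly_Mapping.lookup m e)" for \<tau>
      proof -
        have "- W m * \<tau> = (\<Sum>e\<in>Poly_Mapping.keys m. real (Poly_Mapping.lookup m e) * (- w e * \<tau>))"
          by (simp add: W_def sum_distrib_right sum_negf mult.assoc)
        then have "exp (- W m * \<tau>) = (\<Prod>e\<in>Poly_Mapping.keys m. exp (- w e * \<tau>) ^ Poly_Mapping.lookup m e)"
          by (simp only: exp_sum finite_keys exp_of_nat_mult)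
        then show ?thesis
          by (simp add: eval_monom_def prod.distrib power_mult_distrib)
      qed
      moreover have "((\<lambda>\<tau>. \<Prod>e\<in>Poly_Mapping.keys m. (x \<tau> e * of_real (exp (- w e * \<tau>))) ^ Poly_Mapping.lookup m e) \<longlongrightarrow> L m) at_top"
        unfolding L_def using good[OF that] by (intro tendsto_prod tendsto_power lim) auto
      ultimately show ?thesis by simp
    qed
    have eq: "eval_poly (x \<tau>) g * of_real (exp (- W m0 * \<tau>)) = (\<Sum>m\<in>Poly_Mapping.keys g. Poly_Mapping.lookup g m *
        ((eval_monom (x \<tau>) m * of_real (exp (- W m * \<tau>))) * of_real (exp ((W m - W m0) * \<tau>))))" for \<tau>
    proof -
      have split: "exp (- W m0 * \<tau>) = exp (- W m * \<tau>) * exp ((W m - W m0) * \<tau>)" for m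
        by (simp add: algebra_simps flip: exp_add)
      show ?thesis
        unfolding eval_poly_def sum_distrib_right
      proof (intro sum.cong refl)
        fix m
        show "Poly_Mapping.lookup g m * eval_monom (x \<tau>) m * of_real (exp (- W m0 * \<tau>)) = Poly_Mapping.lookup g m *
          ((eval_monom (x \<tau>) m * of_real (exp (- W m * \<tau>))) * of_real (exp ((W m - W m0) * \<tau>)))"
          unfolding split[of m] by simp
      qed
    qed
    have "((\<lambda>\<tau>. \<Sum>m\<in>Poly_Mapping.keys g. Poly_Mapping.lookup g m *
        ((eval_monom (x \<tau>) m * of_real (exp (- W m * \<tau>))) * of_real (exp ((W m - W m0) * \<tau>)))) \<longlongrightarrow>
        (\<Sum>m\<in>Poly_Mapping.keys g. Poly_Mapping.lookup g m * (L m * of_real (if W m - W m0 = 0 then 1 else 0)))) at_top"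
      using max by (intro tendsto_sum tendsto_mult tendsto_const monom tendsto_of_real exp_decay) auto
    moreover have "(\<Sum>m\<in>Poly_Mapping.keys g. Poly_Mapping.lookup g m * (L m * of_real (if W m - W m0 = 0 then 1 else 0)))
        = (\<Sum>m\<in>Poly_Mapping.keys g. if m = m0 then Poly_Mapping.lookup g m0 else 0)"
    proof (intro sum.cong refl)
      fix m assume m: "m \<in> Poly_Mapping.keys g"
      have "L m0 = 1" by (simp add: L_def F_def)
      then show "Poly_Mapping.lookup g m * (L m * of_real (if W m - W m0 = 0 then 1 else 0)) =
          (if m = m0 then Poly_Mapping.lookup g m0 else 0)"
        using max(2)[OF m] by auto
    qed
    ultimately show ?thesis unfolding eq using m0(1) by simp
  qed
  note lim_g = this
  have "\<exists>\<tau>. eval_poly (x \<tau>) g \<noteq> 0"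
  proof (rule ccontr)
    assume "\<nexists>\<tau>. eval_poly (x \<tau>) g \<noteq> 0"
    then have "((\<lambda>\<tau>::real. 0 :: complex) \<longlongrightarrow> Poly_Mapping.lookup g m0) at_top"
      using lim_g by simp
    then have "Poly_Mapping.lookup g m0 = 0"
      by (simp add: tendsto_const_iff)
    then show False using m0(1) by (simp add: in_keys_iff)
  qed
  then show ?thesis using that van by blast
qed

text \<open>Reduce \<open>f\<close> modulo \<open>J\<close> to a combination \<open>g\<close> of good monomials. If a power of \<open>f\<close> lies in \<open>J\<close>, then \<open>f\<close>
  and hence \<open>g\<close> vanish on the zero set, so \<open>g = 0\<close>. The disjunctions allow a zone without blocks of class
  0 or 2, where the condition on minors of size \<open>Suc s\<close> follows from the one on minors of size \<open>s\<close>.\<close>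

lemma radical_block_ideal:
  assumes d: "1 \<le> d" and J: "ideal J (CX d k1 k2)" and Z: "Z \<inter> T = {}" "Z \<subseteq> grid k1 k2"
    and minors_block: "\<And>l. l \<in> {1..k2} \<Longrightarrow> minors d 2 (block l) \<subseteq> J"
    and minors_mid: "minors d s (zone {1}) \<subseteq> J"
    and minors_left: "zone {0, 1} = zone {1} \<or> minors d (Suc s) (zone {0, 1}) \<subseteq> J"
    and minors_right: "zone {1, 2} = zone {1} \<or> minors d (Suc s) (zone {1, 2}) \<subseteq> J"
    and minors_Z: "minors d 1 Z \<subseteq> J"
    and J_vanish: "\<And>x f. vanishing s Z x \<Longrightarrow> f \<in> J \<Longrightarrow> eval_poly x f = 0"
  shows "radical_ideal J (CX d k1 k2)"
proof -
  have chain_minor: "\<exists>rs cs. chain pos (grid k1 k2) F rs cs \<and>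
      det (mat (length rs) (length rs) (\<lambda>(a, b). x_var (rs ! a) (cs ! b))) \<in> J"
    if F: "F \<subseteq> {1..d} \<times> grid k1 k2" and U: "U \<subseteq> grid k1 k2" "minors d r U \<subseteq> J" and nc: "\<not> chain_free r U F" for F U r
  proof -
    obtain rs cs where ch: "chain pos U F rs cs" "length rs = r"
      using nc by (auto simp: chain_free_def)
    have "sorted_wrt (<) (map pos cs)" using ch(1) by (simp add: chain_def sorted_wrt_map)
    then have "distinct cs" using strict_sorted_iff distinct_map by blast
    moreover have "set rs \<subseteq> {1..d}"
    proof
      fix i assume "i \<in> set rs"
      then obtain a where a: "a < length rs" "i = rs ! a" by (auto simp: in_set_conv_nth)
      then have "(i, cs ! a) \<in> set (zip rs cs)" using ch(1) by (auto simp: chain_def set_zip)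
      then show "i \<in> {1..d}" using ch(1) F unfolding chain_def by blast
    qed
    ultimately have "det (mat r r (\<lambda>(a, b). x_var (rs ! a) (cs ! b))) \<in> J"
      using ch by (intro minor_mem[OF J U(2)]) (auto simp: chain_def)
    moreover have "chain pos (grid k1 k2) F rs cs" using ch(1) U(1) by (auto simp: chain_def)
    ultimately show ?thesis using ch(2) by blast
  qed
  have sub: "block l \<subseteq> grid k1 k2" "zone B \<subseteq> grid k1 k2" for l B
    using T_grid by (auto simp: block_def zone_def)
  have shorten: "chain_free (Suc s) U F" if "chain_free s U F" for U F
    unfolding chain_free_def
  proof (intro notI, elim exE conjE)
    fix rs cs assume ch: "chain pos U F rs cs" "length rs = Suc s"
    have "chain pos U F (take s rs) (take s cs)"
      using ch unfolding chain_def
      by (auto simp: sorted_wrt_take take_zip[symmetric] dest: in_set_takeD)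
    then show False using that ch(2) by (auto simp: chain_free_def)
  qed
  have bad: "\<exists>rs cs. chain pos (grid k1 k2) F rs cs \<and>
      det (mat (length rs) (length rs) (\<lambda>(a, b). x_var (rs ! a) (cs ! b))) \<in> J"
    if F: "F \<subseteq> {1..d} \<times> grid k1 k2" and ng: "\<not> good s Z F" for F
  proof -
    consider l where "l \<in> {1..k2}" "\<not> chain_free 2 (block l) F" | "\<not> chain_free s (zone {1}) F"
      | "chain_free s (zone {1}) F" "\<not> chain_free (Suc s) (zone {0, 1}) F"
      | "chain_free s (zone {1}) F" "\<not> chain_free (Suc s) (zone {1, 2}) F"
      | i c where "(i, c) \<in> F" "c \<in> Z"
      using ng unfolding good_def by blast
    then show ?thesis
    proof cases
      case 1
      then show ?thesis using chain_minor[OF F sub(1) minors_block] by blast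
    next
      case 2
      then show ?thesis using chain_minor[OF F sub(2) minors_mid] by blast
    next
      case 3
      then have "minors d (Suc s) (zone {0, 1}) \<subseteq> J" using minors_left shorten by metis
      then show ?thesis using chain_minor[OF F sub(2)] 3 by blast
    next
      case 4
      then have "minors d (Suc s) (zone {1, 2}) \<subseteq> J" using minors_right shorten by metis
      then show ?thesis using chain_minor[OF F sub(2)] 4 by blast
    next
      case 5
      then have "chain pos Z F [i] [c]" by (simp add: chain_def)
      then have "\<not> chain_free 1 Z F" unfolding chain_free_def by force
      then show ?thesis using chain_minor[OF F Z(2) minors_Z] by blast
    qed
  qed
  have "f \<in> J" if f: "f \<in> carrier (CX d k1 k2)" "f ^ n \<in> J" "n > 0" for f n
  proof -
    obtain g where g: "f - g \<in> J" "\<And>m. m \<in> Poly_Mapping.keys g \<Longrightarrow>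
        Poly_Mapping.keys m \<subseteq> {1..d} \<times> grid k1 k2 \<and> good s Z (Poly_Mapping.keys m)"
      using poly_reduction[OF J bad f(1)] by blast
    have "g = 0"
    proof (rule ccontr)
      assume "g \<noteq> 0"
      then obtain x where x: "vanishing s Z x" "eval_poly x g \<noteq> 0"
        using good_polys_independent[OF d Z(1) _ g(2)] by blast
      interpret comm_ring_hom "eval_poly x" by (rule comm_ring_hom_eval_poly)
      have "eval_poly x f ^ n = 0" using J_vanish[OF x(1) f(2)] by (simp add: hom_power)
      then have "eval_poly x f = 0" by simp
      moreover have "eval_poly x (f - g) = 0" using J_vanish[OF x(1) g(1)] .
      ultimately show False using x(2) by (simp add: hom_minus)
    qed
    then show ?thesis using g(1) by simp
  qed
  moreover have "f \<in> carrier (CX d k1 k2)" if "f \<in> J" for f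
    using that ideal_CX_closed(1)[OF J] by blast
  ultimately show ?thesis
    unfolding radical_ideal_def radical_of_def CX_pow using J
    by (auto intro: exI[of _ "1::nat"])
qed

end

section \<open>The ideals \<open>I\<^sub>S\<close> and \<open>J\<^sub>S\<close>\<close>

lemma set_plus_CX_ideals:
  assumes "ideal I (CX d k1 k2)" "ideal J (CX d k1 k2)"
  shows "ideal (I + J) (CX d k1 k2)" "I \<subseteq> I + J" "J \<subseteq> I + J"
proof -
  interpret cring "CX d k1 k2" by (rule cring_CX)
  have "I + J = I <+>\<^bsub>CX d k1 k2\<^esub> J"
    by (auto simp: set_plus_def set_add_def set_mult_def CX_def)
  then show "ideal (I + J) (CX d k1 k2)" using add_ideals[OF assms] by simp
  show "I \<subseteq> I + J" "J \<subseteq> I + J"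
    using ideal_CX_closed(2)[OF assms(1)] ideal_CX_closed(2)[OF assms(2)]
    by (force simp: set_plus_def)+
qed

lemma ideal_CX_zero: "ideal 0 (CX d k1 k2)"
proof -
  interpret cring "CX d k1 k2" by (rule cring_CX)
  have "ideal {\<zero>\<^bsub>CX d k1 k2\<^esub>} (CX d k1 k2)" by (rule zeroideal)
  then show ?thesis by (simp add: CX_def set_zero)
qed

lemma set_sum_CX_ideals:
  assumes "finite A" "\<And>i. i \<in> A \<Longrightarrow> ideal (I i) (CX d k1 k2)"
  shows "ideal (\<Sum>i\<in>A. I i) (CX d k1 k2) \<and> (\<forall>i\<in>A. I i \<subseteq> (\<Sum>i\<in>A. I i))"
  using assms
proof (induction A rule: finite_induct)
  case empty
  then show ?case using ideal_CX_zero by simp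
next
  case (insert a A)
  then have IH: "ideal (\<Sum>i\<in>A. I i) (CX d k1 k2)" "\<forall>i\<in>A. I i \<subseteq> (\<Sum>i\<in>A. I i)" and a: "ideal (I a) (CX d k1 k2)"
    by auto
  show ?case
    using set_plus_CX_ideals[OF a IH(1)] IH(2) insert.hyps by auto
qed

lemma minor_ideal_gen: "U \<subseteq> grid k1 k2 \<Longrightarrow> minors d r U \<subseteq> minor_ideal d k1 k2 r U"
  unfolding minor_ideal_def using ring.genideal_self[OF cring.axioms(1)[OF cring_CX] minors_closed] .

text \<open>The polynomials that vanish at \<open>x\<close> form an ideal, so they comprise an ideal as soon as they
  comprise its generators.\<close>

lemma eval_vanishes_genideal:
  assumes "S \<subseteq> carrier (CX d k1 k2)" "\<And>p. p \<in> S \<Longrightarrow> eval_poly x p = 0" "f \<in> Idl\<^bsub>CX d k1 k2\<^esub> S"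
  shows "eval_poly x f = 0"
proof -
  have "Idl\<^bsub>CX d k1 k2\<^esub> S \<subseteq> {f \<in> carrier (CX d k1 k2). eval_poly x f = 0}"
    using assms(1,2) by (intro ring.genideal_minimal[OF cring.axioms(1)[OF cring_CX] ideal_eval_kernel]) auto
  then show ?thesis using assms(3) by blast
qed

lemma eval_vanishes_minor_ideal:
  assumes "U \<subseteq> grid k1 k2" "\<And>p. p \<in> minors d r U \<Longrightarrow> eval_poly x p = 0" "f \<in> minor_ideal d k1 k2 r U"
  shows "eval_poly x f = 0"
  using eval_vanishes_genideal[OF minors_closed[OF assms(1)] assms(2)] assms(3) unfolding minor_ideal_def by blast

lemma eval_vanishes_set_sum:
  assumes "finite A" "\<And>i g. i \<in> A \<Longrightarrow> g \<in> I i \<Longrightarrow> eval_poly x g = 0" "f \<in> (\<Sum>i\<in>A. I i)"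
  shows "eval_poly x f = 0"
  using assms
proof (induction A arbitrary: f rule: finite_induct)
  case empty
  then show ?case by (simp add: set_zero)
next
  case (insert a A)
  then obtain g h where gh: "f = g + h" "g \<in> I a" "h \<in> (\<Sum>i\<in>A. I i)"
    by (auto simp: set_plus_def)
  have "eval_poly x h = 0"
  proof (rule insert.IH[OF _ gh(3)])
    show "eval_poly x g = 0" if "i \<in> A" "g \<in> I i" for i g
      using insert.prems(1)[of i g] that by blast
  qed
  moreover have "eval_poly x g = 0" using insert.prems(1) gh(2) by blast
  ultimately show ?case by (simp add: gh(1) eval_poly_add)
qed

lemma inj_on_mixed_radix:
  fixes q :: "nat \<Rightarrow> nat"
  assumes "inj_on q {1..k2}"
  shows "inj_on (\<lambda>(j, l). q l * Suc k1 + j) (grid k1 k2)"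
proof (rule inj_onI)
  fix c c' assume c: "c \<in> grid k1 k2" "c' \<in> grid k1 k2"
    and eq: "(case c of (j, l) \<Rightarrow> q l * Suc k1 + j) = (case c' of (j, l) \<Rightarrow> q l * Suc k1 + j)"
  obtain j l j' l' where jl: "c = (j, l)" "c' = (j', l')" by fastforce
  have j: "j < Suc k1" "j' < Suc k1" and l: "l \<in> {1..k2}" "l' \<in> {1..k2}"
    using c by (auto simp: grid_def jl)
  have "q l * Suc k1 + j = q l' * Suc k1 + j'" using eq by (simp add: jl)
  from arg_cong[OF this, of "\<lambda>n. n div Suc k1"] arg_cong[OF this, of "\<lambda>n. n mod Suc k1"]
  have "q l = q l'" "j = j'"
    using j by (simp_all only: div_mult_self3 mod_mult_self3 div_less mod_less)
  then show "c = c'" using inj_onD[OF assms _ l] by (simp add: jl)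
qed

lemma mixed_radix_less:
  fixes q :: "nat \<Rightarrow> nat"
  assumes "q l < q l'" "j \<le> k1"
  shows "q l * Suc k1 + j < q l' * Suc k1 + j'"
proof -
  have "q l * Suc k1 + j < Suc (q l) * Suc k1" using assms(2) by simp
  also have "\<dots> \<le> q l' * Suc k1" using assms(1) by (intro mult_le_mono1) simp
  finally show ?thesis by simp
qed

text \<open>All blocks are complete and of class 1, so that the only zone is the whole matrix.\<close>

lemma radical_I_empty:
  assumes "1 \<le> k1" "1 \<le> d"
  shows "radical_ideal (I_empty d k1 k2 t) (CX d k1 k2)"
proof -
  interpret block_arrangement d k1 k2 "grid k1 k2" "\<lambda>(j, l). id l * Suc k1 + j" id "\<lambda>_. 1"
  proof
    show "\<exists>c\<in>grid k1 k2. snd c = l" if "l \<in> {1..k2}" for l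
      using that assms(1) by (intro bexI[of _ "(1, l)"]) (auto simp: grid_def)
    show "inj_on (\<lambda>(j, l). id l * Suc k1 + j) (grid k1 k2)"
      by (rule inj_on_mixed_radix) simp
    show "(case c of (j, l) \<Rightarrow> id l * Suc k1 + j) < (case c' of (j, l) \<Rightarrow> id l * Suc k1 + j)"
      if "c \<in> grid k1 k2" "c' \<in> grid k1 k2" "id (snd c) < id (snd c')" for c c'
      using that mixed_radix_less[of id "snd c" "snd c'" "fst c" k1 "fst c'"] by (auto simp: grid_def)
  qed auto
  have zone: "zone {1} = grid k1 k2" "zone {0, 1} = grid k1 k2" "zone {1, 2} = grid k1 k2"
    unfolding zone_def by auto
  have block: "block l = C_set k1 l" "C_set k1 l \<subseteq> grid k1 k2" if "l \<in> {1..k2}" for l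
    using that unfolding block_def by (auto simp: C_set_def grid_def)
  have minors_ideal: "ideal (minor_ideal d k1 k2 t (grid k1 k2)) (CX d k1 k2)"
    by (rule ideal_minor_ideal) simp
  have sum_ideal: "ideal (\<Sum>l\<in>{1..k2}. minor_ideal d k1 k2 2 (C_set k1 l)) (CX d k1 k2)"
    "\<forall>l\<in>{1..k2}. minor_ideal d k1 k2 2 (C_set k1 l) \<subseteq> (\<Sum>l\<in>{1..k2}. minor_ideal d k1 k2 2 (C_set k1 l))"
    using set_sum_CX_ideals[of "{1..k2}" "\<lambda>l. minor_ideal d k1 k2 2 (C_set k1 l)" d k1 k2]
      ideal_minor_ideal block(2) by auto
  note I = set_plus_CX_ideals[OF minors_ideal sum_ideal(1), folded I_empty_def]
  show ?thesis
  proof (rule radical_block_ideal[where s = t and Z = "{}"])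
    show "minors d 2 (block l) \<subseteq> I_empty d k1 k2 t" if "l \<in> {1..k2}" for l
      using minor_ideal_gen[OF block(2)[OF that], of d 2] sum_ideal(2) I(3) that
      unfolding block(1)[OF that] by blast
    show "minors d t (zone {1}) \<subseteq> I_empty d k1 k2 t"
      unfolding zone using minor_ideal_gen[of "grid k1 k2" k1 k2 d t] I(2) by blast
    show "minors d 1 {} \<subseteq> I_empty d k1 k2 t"
      by (auto simp: minors_def)
  next
    fix x f assume x: "vanishing t {} x" and f: "f \<in> I_empty d k1 k2 t"
    obtain g h where gh: "f = g + h" "g \<in> minor_ideal d k1 k2 t (grid k1 k2)"
      "h \<in> (\<Sum>l\<in>{1..k2}. minor_ideal d k1 k2 2 (C_set k1 l))"
      using f by (auto simp: I_empty_def set_plus_def)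
    have "eval_poly x g = 0"
    proof (rule eval_vanishes_minor_ideal[OF _ _ gh(2)])
      show "eval_poly x p = 0" if "p \<in> minors d t (grid k1 k2)" for p
        using vanishingD(2)[OF x] that unfolding zone .
    qed simp
    moreover have "eval_poly x h = 0"
    proof (rule eval_vanishes_set_sum[OF _ _ gh(3)])
      fix l p assume l: "l \<in> {1..k2}" and p: "p \<in> minor_ideal d k1 k2 2 (C_set k1 l)"
      show "eval_poly x p = 0"
      proof (rule eval_vanishes_minor_ideal[OF block(2)[OF l] _ p])
        show "eval_poly x p = 0" if "p \<in> minors d 2 (C_set k1 l)" for p
          using vanishingD(1)[OF x l] that unfolding block(1)[OF l] .
      qed
    qed simp
    ultimately show "eval_poly x f = 0" by (simp add: gh(1) eval_poly_add)
  next
    show "1 \<le> d" by (rule assms(2))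
    show "ideal (I_empty d k1 k2 t) (CX d k1 k2)" by (rule I(1))
    show "zone {0, 1} = zone {1} \<or> minors d (Suc t) (zone {0, 1}) \<subseteq> I_empty d k1 k2 t"
      "zone {1, 2} = zone {1} \<or> minors d (Suc t) (zone {1, 2}) \<subseteq> I_empty d k1 k2 t"
      unfolding zone by simp_all
  qed simp_all
qed

lemma C_set_2: "C_set 2 l = {(1, l), (2, l)}"
proof -
  have "{1..2::nat} = {1, 2}" by auto
  then show ?thesis by (simp add: C_set_def)
qed

text \<open>A block that meets \<open>S\<close> has one column left outside \<open>S\<close>. It is of class 0 if this column belongs to
  \<open>R\<^sub>1\<close> and of class 2 if it belongs to \<open>R\<^sub>2\<close>; the blocks that avoid \<open>S\<close> are of class 1. Then the zones
  \<open>{1}\<close>, \<open>{0, 1}\<close> and \<open>{1, 2}\<close> are the column sets of the three families of larger minors. The two ideals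
  differ only in whether the columns \<open>S\<close> are set to zero.\<close>

lemma radical_J_and_I:
  assumes S: "S \<subseteq> grid 2 k2" "S \<noteq> {}" and no_block: "\<And>l. l \<in> {1..k2} \<Longrightarrow> \<not> C_set 2 l \<subseteq> S"
    and "1 \<le> d" "1 \<le> t"
  shows "radical_ideal (J_ideal d k2 t S) (CX d 2 k2)" "radical_ideal (I_ideal d k2 t S) (CX d 2 k2)"
proof -
  \<comment> \<open>The arrangement lists the blocks by class, then by index, and the columns of a block by their row
    \<open>R\<^sub>j\<close>, encoded in mixed radix.\<close>
  define cls :: "nat \<Rightarrow> nat" where "cls l = (if (2, l) \<in> S then 0 else if (1, l) \<in> S then 2 else 1)" for l
  define q where "q l = cls l * Suc k2 + l" for l
  have not_both: "(1, l) \<notin> S \<or> (2, l) \<notin> S" if "l \<in> {1..k2}" for l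
  proof (rule ccontr)
    assume "\<not> ?thesis"
    then have "C_set 2 l \<subseteq> S" unfolding C_set_2 by auto
    then show False using no_block[OF that] by blast
  qed
  have q_less: "q l < q l'" if "cls l < cls l'" "l \<in> {1..k2}" for l l'
    using that mixed_radix_less[of cls l l' l k2 l'] by (simp add: q_def)
  have q_inj: "inj_on q {1..k2}"
  proof (rule inj_onI)
    fix l l' assume *: "l \<in> {1..k2}" "l' \<in> {1..k2}" "q l = q l'"
    then have "cls l = cls l'" using q_less[of l l'] q_less[of l' l] by (metis less_irrefl linorder_neqE_nat)
    then show "l = l'" using *(3) by (simp add: q_def)
  qed
  interpret block_arrangement d 2 k2 "grid 2 k2 - S" "\<lambda>(j, l). q l * Suc 2 + j" q cls
  proof
    show "grid 2 k2 - S \<subseteq> grid 2 k2" by blast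
    show "\<exists>c\<in>grid 2 k2 - S. snd c = l" if l: "l \<in> {1..k2}" for l
    proof (cases "(1, l) \<in> S")
      case True
      then show ?thesis using not_both[OF l] l by (intro bexI[of _ "(2, l)"]) (auto simp: grid_def)
    next
      case False
      then show ?thesis using l by (intro bexI[of _ "(1, l)"]) (auto simp: grid_def)
    qed
    show "inj_on (\<lambda>(j, l). q l * Suc 2 + j) (grid 2 k2)"
      by (rule inj_on_mixed_radix[OF q_inj])
    show "inj_on q {1..k2}" by (rule q_inj)
    show "(case c of (j, l) \<Rightarrow> q l * Suc 2 + j) < (case c' of (j, l) \<Rightarrow> q l * Suc 2 + j)"
      if "c \<in> grid 2 k2" "c' \<in> grid 2 k2" "q (snd c) < q (snd c')" for c c'
    proof -
      have "fst c \<le> 2" using that(1) by (auto simp: grid_def)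
      then show ?thesis
        using mixed_radix_less[of q "snd c" "snd c'" "fst c" 2 "fst c'"] that(3) by (simp add: case_prod_beta)
    qed
    show "cls l \<le> cls l'" if "l \<in> {1..k2}" "l' \<in> {1..k2}" "q l \<le> q l'" for l l'
      using q_less[of l' l] that by (metis linorder_not_less)
    show "cls l \<le> 2" for l by (simp add: cls_def)
  qed
  have in_grid: "(j, l) \<in> grid 2 k2 \<longleftrightarrow> (j = 1 \<or> j = 2) \<and> l \<in> {1..k2}" for j l
    by (auto simp: grid_def)
  have in_CC: "(j, l) \<in> CC k2 S \<longleftrightarrow> (j, l) \<in> grid 2 k2 \<and> (1, l) \<notin> S \<and> (2, l) \<notin> S" for j l
  proof -
    have "C_set 2 l \<inter> S = {} \<longleftrightarrow> (1, l) \<notin> S \<and> (2, l) \<notin> S"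
      unfolding C_set_2 by auto
    moreover have "(j, l) \<in> CC k2 S \<longleftrightarrow> (j, l) \<in> grid 2 k2 \<and> C_set 2 l \<inter> S = {}"
      by (auto simp: CC_def free_columns_def C_set_def grid_def)
    ultimately show ?thesis by simp
  qed
  have mid: "zone {1} = CC k2 S"
  proof (rule Set.set_eqI, clarify)
    show "(j, l) \<in> zone {1} \<longleftrightarrow> (j, l) \<in> CC k2 S" for j l
      unfolding zone_def mem_Collect_eq in_CC Diff_iff in_grid cls_def by auto
  qed
  have left: "zone {0, 1} = (R_set k2 1 - S) \<union> CC k2 S"
  proof (rule Set.set_eqI, clarify)
    show "(j, l) \<in> zone {0, 1} \<longleftrightarrow> (j, l) \<in> (R_set k2 1 - S) \<union> CC k2 S" for j l
      using not_both[of l]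
      unfolding zone_def mem_Collect_eq Un_iff in_CC Diff_iff in_grid cls_def R_set_def by auto
  qed
  have right: "zone {1, 2} = (R_set k2 2 - S) \<union> CC k2 S"
  proof (rule Set.set_eqI, clarify)
    show "(j, l) \<in> zone {1, 2} \<longleftrightarrow> (j, l) \<in> (R_set k2 2 - S) \<union> CC k2 S" for j l
      using not_both[of l]
      unfolding zone_def mem_Collect_eq Un_iff in_CC Diff_iff in_grid cls_def R_set_def by auto
  qed
  have free_block: "block l = C_set 2 l" if "l \<in> free_columns k2 S" for l
    using that unfolding block_def by (auto simp: free_columns_def C_set_2 grid_def)
  have other_block: "minors d 2 (block l) = {}" if "l \<in> {1..k2}" "l \<notin> free_columns k2 S" for l
  proof -
    have "(1, l) \<in> S \<or> (2, l) \<in> S"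
      using that unfolding free_columns_def C_set_2 by auto
    then have "\<exists>j. \<forall>c\<in>block l. c = (j, l)"
    proof
      assume "(1, l) \<in> S"
      then show ?thesis unfolding block_def by (intro exI[of _ 2]) (auto simp: in_grid)
    next
      assume "(2, l) \<in> S"
      then show ?thesis unfolding block_def by (intro exI[of _ 1]) (auto simp: in_grid)
    qed
    then obtain j where j: "\<And>c. c \<in> block l \<Longrightarrow> c = (j, l)" by blast
    have "\<not> (length cs = 2 \<and> sorted_wrt (\<lambda>c c'. (c, c') \<in> less_than <*lex*> less_than) cs \<and> set cs \<subseteq> block l)" for cs
    proof
      assume *: "length cs = 2 \<and> sorted_wrt (\<lambda>c c'. (c, c') \<in> less_than <*lex*> less_than) cs \<and> set cs \<subseteq> block l"
      then have "cs ! 0 \<in> block l" "cs ! 1 \<in> block l"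
        using nth_mem[of 0 cs] nth_mem[of 1 cs] by auto
      then have "cs ! 0 = (j, l)" "cs ! 1 = (j, l)" using j by blast+
      moreover have "(cs ! 0, cs ! 1) \<in> less_than <*lex*> less_than"
        using * by (intro sorted_wrt_nth_less[of "\<lambda>c c'. (c, c') \<in> less_than <*lex*> less_than"]) auto
      ultimately show False by simp
    qed
    then show ?thesis unfolding minors_def by blast
  qed
  let ?G = "(\<Union>l\<in>free_columns k2 S. minors d 2 (C_set 2 l)) \<union> minors d (t - 1) (CC k2 S) \<union>
        minors d t ((R_set k2 1 - S) \<union> CC k2 S) \<union> minors d t ((R_set k2 2 - S) \<union> CC k2 S)"
  have t: "Suc (t - 1) = t" using assms by simp
  have sub: "C_set 2 l \<subseteq> grid 2 k2" if "l \<in> free_columns k2 S" for l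
    using that by (auto simp: free_columns_def C_set_def grid_def)
  have zone_sub: "zone B \<subseteq> grid 2 k2" for B by (auto simp: zone_def)
  have G: "?G \<subseteq> carrier (CX d 2 k2)"
    using minors_closed[OF sub] minors_closed[OF zone_sub, of d _ "{1}"]
      minors_closed[OF zone_sub, of d _ "{0, 1}"] minors_closed[OF zone_sub, of d _ "{1, 2}"]
    unfolding mid left right by blast
  have J_def: "J_ideal d k2 t S = Idl\<^bsub>CX d 2 k2\<^esub> ?G" using S by (simp add: J_ideal_def)
  have J: "ideal (J_ideal d k2 t S) (CX d 2 k2)" "?G \<subseteq> J_ideal d k2 t S"
    unfolding J_def
    using ring.genideal_ideal[OF cring.axioms(1)[OF cring_CX] G] ring.genideal_self[OF cring.axioms(1)[OF cring_CX] G]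
    by auto
  have block_J: "minors d 2 (block l) \<subseteq> J_ideal d k2 t S" if "l \<in> {1..k2}" for l
    using other_block[OF that] free_block J(2) by (cases "l \<in> free_columns k2 S") auto
  have zones_J: "minors d (t - 1) (zone {1}) \<subseteq> J_ideal d k2 t S"
    "minors d (Suc (t - 1)) (zone {0, 1}) \<subseteq> J_ideal d k2 t S" "minors d (Suc (t - 1)) (zone {1, 2}) \<subseteq> J_ideal d k2 t S"
    unfolding mid left right t using J(2) by blast+
  have J_vanish: "eval_poly x f = 0" if x: "vanishing (t - 1) Z x" and f: "f \<in> J_ideal d k2 t S" for x f Z
  proof (rule eval_vanishes_genideal[OF G _ f[unfolded J_def]])
    fix p assume "p \<in> ?G"
    then consider l where "l \<in> free_columns k2 S" "p \<in> minors d 2 (C_set 2 l)"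
      | "p \<in> minors d (t - 1) (CC k2 S)" | "p \<in> minors d t ((R_set k2 1 - S) \<union> CC k2 S)"
      | "p \<in> minors d t ((R_set k2 2 - S) \<union> CC k2 S)"
      by blast
    then show "eval_poly x p = 0"
    proof cases
      case 1
      then have "l \<in> {1..k2}" by (simp add: free_columns_def)
      then show ?thesis using vanishingD(1)[OF x] 1 free_block by simp
    qed (rule vanishingD[OF x, unfolded mid left right t], assumption)+
  qed
  have empty: "minors d 1 {} = {}" by (auto simp: minors_def)
  show "radical_ideal (J_ideal d k2 t S) (CX d 2 k2)"
  proof (rule radical_block_ideal[where s = "t - 1" and Z = "{}"])
    show "eval_poly x f = 0" if "vanishing (t - 1) {} x" "f \<in> J_ideal d k2 t S" for x f
      using J_vanish that by blast
  next
    show "minors d 1 {} \<subseteq> J_ideal d k2 t S" unfolding empty by simp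
  qed (use \<open>1 \<le> d\<close> J(1) block_J zones_J in blast)+
  have I_def: "I_ideal d k2 t S = minor_ideal d 2 k2 1 S + J_ideal d k2 t S"
    using S by (simp add: I_ideal_def)
  note I = set_plus_CX_ideals[OF ideal_minor_ideal[OF S(1), of d 1] J(1), folded I_def]
  show "radical_ideal (I_ideal d k2 t S) (CX d 2 k2)"
  proof (rule radical_block_ideal[where s = "t - 1" and Z = S])
    fix x f assume x: "vanishing (t - 1) S x" and "f \<in> I_ideal d k2 t S"
    then obtain g h where gh: "f = g + h" "g \<in> minor_ideal d 2 k2 1 S" "h \<in> J_ideal d k2 t S"
      by (auto simp: I_def set_plus_def)
    have "eval_poly x g = 0"
    proof (rule eval_vanishes_minor_ideal[OF S(1) _ gh(2)])
      show "eval_poly x p = 0" if "p \<in> minors d 1 S" for p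
        using vanishingD(5)[OF x that] .
    qed
    then show "eval_poly x f = 0" using J_vanish[OF x gh(3)] by (simp add: gh(1) eval_poly_add)
  next
    show "minors d 1 S \<subseteq> I_ideal d k2 t S" using minor_ideal_gen[OF S(1), of d 1] I(2) by blast
  qed (use \<open>1 \<le> d\<close> I(1,3) S(1) block_J zones_J in blast)+
qed

theorem corollary4p6:
  fixes k1 k2 d t :: nat
  assumes "2 \<le> t" and "t \<le> min k2 d"
  shows "(k1 \<ge> 2 \<longrightarrow> radical_ideal (I_empty d k1 k2 t) (CX d k1 k2)) \<and>
         (\<forall>S \<subseteq> grid 2 k2. minimal_set k2 t S \<longrightarrow>
            radical_ideal (I_ideal d k2 t S) (CX d 2 k2) \<and>
            radical_ideal (J_ideal d k2 t S) (CX d 2 k2))"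
proof (intro conjI allI impI)
  have d: "1 \<le> d" using assms by simp
  show "radical_ideal (I_empty d k1 k2 t) (CX d k1 k2)" if "2 \<le> k1"
    using that d by (intro radical_I_empty) simp_all
  fix S assume S: "S \<subseteq> grid 2 k2" "minimal_set k2 t S"
  show "radical_ideal (I_ideal d k2 t S) (CX d 2 k2)" "radical_ideal (J_ideal d k2 t S) (CX d 2 k2)"
    using radical_I_empty[of 2 d k2 t] radical_J_and_I[of S k2 d t] S d assms(1)
    by (cases "S = {}"; simp add: I_ideal_def J_ideal_def minimal_set_def)+
qed

end
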